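(* Let $\mathbb{K}=\mathbb{R}$ or $\mathbb{K}=\mathbb{C}$, $A\in Gl(d,\mathbb{K})$, $B\in\mathbb{K}^{d\times m}$, and let $U\subset\mathbb{K}^m$ be a compact convex neighborhood of $0$ with $U=\overline{\mathrm{int}\,U}$. Consider the control system $x_{k+1}=Ax_k+Bu_k$, $u_k\in U$, $k\in\mathbb{N}_0$, in $\mathbb{K}^d$ and suppose that the system without control restriction is controllable (i.e. $\mathrm{rank}[B\ AB\ \cdots\ A^{d-1}B]=d$). (i) There exists a compact and convex set $K\subset E^s\subset\mathbb{K}^d$ with nonvoid interior with respect to $E^s$ such that $\overline{\mathbf{R}(0)}=K+E^{uc}$. Moreover, $0\in K$ and $E^{uc}\subset\mathrm{int}\,\mathbf{R}(0)$. (ii) There exists a compact and convex set $F\subset E^u\subset\mathbb{K}^d$ with nonvoid interior with respect to $E^u$ such that $\overline{\mathbf{C}(0)}=F+E^{sc}$. Moreover, $0\in F$ and $E^{sc}\subset\mathrm{int}\,\mathbf{C}(0)$.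
   Context: $\mathbb{N}=\{1,2,\dots\}$, $\mathbb{N}_0=\{0,1,2,\dots\}$, $\mathcal{U}=U^{\mathbb{N}_0}$. For $x\in\mathbb{K}^d$, $u=(u_i)\in\mathcal{U}$ the solution is $\varphi(k,x,u)=A^kx+\sum_{i=0}^{k-1}A^{k-1-i}Bu_i$. $\mathbf{R}(0)=\{\varphi(k,0,u)\mid k\in\mathbb{N},u\in\mathcal{U}\}$ is the reachable set from $0$ and $\mathbf{C}(0)=\{y\in\mathbb{K}^d\mid\exists k\in\mathbb{N},u\in\mathcal{U}:\varphi(k,y,u)=0\}$ is the controllable set to $0$. $E^s$, $E^c$, $E^u$ are the direct sums of all generalized eigenspaces (generalized real eigenspaces if $\mathbb{K}=\mathbb{R}$) of $A$ for the eigenvalues $\lambda$ with $|\lambda|<1$, $|\lambda|=1$, $|\lambda|>1$, respectively, so that $\mathbb{K}^d=E^s\oplus E^c\oplus E^u$. Further $E^{uc}=E^u\oplus E^c$ and $E^{sc}=E^s\oplus E^c$. *)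

theory Defs
  imports "HOL-Analysis.Analysis"
begin

text \<open>
  Powers of a matrix act as iterates of \<open>(*v) A\<close>: the power operation on \<open>'k^'d^'d\<close>
  is componentwise.
\<close>

definition solution ::
    "'k::field^'d^'d \<Rightarrow> 'k^'m^'d \<Rightarrow> nat \<Rightarrow> 'k^'d \<Rightarrow> (nat \<Rightarrow> 'k^'m) \<Rightarrow> 'k^'d" where
  "solution A B k x u =
     ((*v) A ^^ k) x + (\<Sum>i<k. ((*v) A ^^ (k - 1 - i)) (B *v u i))"

definition controls :: "('k^'m) set \<Rightarrow> (nat \<Rightarrow> 'k^'m) set" where
  "controls U = {u. \<forall>i. u i \<in> U}"

definition reachable_set ::
    "'k::field^'d^'d \<Rightarrow> 'k^'m^'d \<Rightarrow> ('k^'m) set \<Rightarrow> ('k^'d) set" where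
  "reachable_set A B U = {solution A B k 0 u | k u. k \<ge> 1 \<and> u \<in> controls U}"

definition controllable_set ::
    "'k::field^'d^'d \<Rightarrow> 'k^'m^'d \<Rightarrow> ('k^'m) set \<Rightarrow> ('k^'d) set" where
  "controllable_set A B U = {y. \<exists>k u. k \<ge> 1 \<and> u \<in> controls U \<and> solution A B k y u = 0}"

text \<open>
  The block matrix \<open>[B  AB  \<dots>  A^(d-1) B]\<close>. Its columns are indexed by pairs of a block
  index and a column index of \<open>B\<close>; \<open>to_nat_on UNIV\<close> is a bijection from the index
  type \<open>'d\<close> onto \<open>{..<CARD('d)}\<close>, and the order of the blocks does not affect the rank.
\<close>

definition kalman_matrix :: "'k::field^'d^'d \<Rightarrow> 'k^'m^'d \<Rightarrow> 'k^('d \<times> 'm)^'d" where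
  "kalman_matrix A B =
     (\<chi> i p. ((*v) A ^^ to_nat_on (UNIV :: 'd set) (fst p)) (column (snd p) B) $ i)"

definition eigenvalues :: "'k::field^'d^'d \<Rightarrow> 'k set" where
  "eigenvalues A = {\<mu>. \<exists>v. v \<noteq> 0 \<and> A *v v = \<mu> *s v}"

definition gen_eigenspace :: "'k::field^'d^'d \<Rightarrow> 'k \<Rightarrow> ('k^'d) set" where
  "gen_eigenspace A \<mu> = {v. \<exists>n. ((\<lambda>w. A *v w - \<mu> *s w) ^^ n) v = 0}"

text \<open>The complex-linear span is \<open>vec.span\<close>; \<open>span\<close> would be the real-linear one.\<close>

definition spectral_sum_complex :: "complex^'d^'d \<Rightarrow> complex set \<Rightarrow> (complex^'d) set" where
  "spectral_sum_complex A S = vec.span (\<Union>\<mu> \<in> eigenvalues A \<inter> S. gen_eigenspace A \<mu>)"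

text \<open>
  For a real matrix, the eigenvalues are those of its complexification, and the generalized
  real eigenspace of \<open>\<mu>\<close> (equivalently, of the pair \<open>\<mu>, cnj \<mu>\<close>) is spanned by the real and
  imaginary parts of the complex generalized eigenvectors for \<open>\<mu>\<close>.
\<close>

definition gen_real_eigenspace :: "real^'d^'d \<Rightarrow> complex \<Rightarrow> (real^'d) set" where
  "gen_real_eigenspace A \<mu> =
     (let G = gen_eigenspace (map_matrix complex_of_real A) \<mu>
      in span ((\<lambda>v. \<chi> i. Re (v $ i)) ` G \<union> (\<lambda>v. \<chi> i. Im (v $ i)) ` G))"

definition spectral_sum_real :: "real^'d^'d \<Rightarrow> complex set \<Rightarrow> (real^'d) set" where
  "spectral_sum_real A S =
     span (\<Union>\<mu> \<in> eigenvalues (map_matrix complex_of_real A) \<inter> S. gen_real_eigenspace A \<mu>)"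

definition stable_space_complex :: "complex^'d^'d \<Rightarrow> (complex^'d) set" where
  "stable_space_complex A = spectral_sum_complex A {\<mu>. cmod \<mu> < 1}"

definition center_space_complex :: "complex^'d^'d \<Rightarrow> (complex^'d) set" where
  "center_space_complex A = spectral_sum_complex A {\<mu>. cmod \<mu> = 1}"

definition unstable_space_complex :: "complex^'d^'d \<Rightarrow> (complex^'d) set" where
  "unstable_space_complex A = spectral_sum_complex A {\<mu>. cmod \<mu> > 1}"

definition stable_space_real :: "real^'d^'d \<Rightarrow> (real^'d) set" where
  "stable_space_real A = spectral_sum_real A {\<mu>. cmod \<mu> < 1}"

definition center_space_real :: "real^'d^'d \<Rightarrow> (real^'d) set" where
  "center_space_real A = spectral_sum_real A {\<mu>. cmod \<mu> = 1}"

definition unstable_space_real :: "real^'d^'d \<Rightarrow> (real^'d) set" where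
  "unstable_space_real A = spectral_sum_real A {\<mu>. cmod \<mu> > 1}"

end

theory Submission
  imports Defs "HOL-Computational_Algebra.Fundamental_Theorem_Algebra"
begin

text \<open>
  For a linear map \<open>T\<close> and an input set \<open>W\<close>, the reachable set \<open>R\<close> is the increasing union of the
  convex sets \<open>\<Sum>i<k. T^i W\<close>, and it is a neighbourhood of \<open>0\<close> by controllability.

  If a point of \<open>E\<^sup>u\<^sup>c\<close> were outside \<open>closure R\<close>, a separating functional \<open>f\<close> would be bounded above
  on \<open>R\<close>. Choosing the signs of the inputs makes \<open>\<Sum>\<bar>f (T^n w)\<bar>\<close> converge for small \<open>w\<close>, hence
  \<open>f (T^n y) \<longlonglongrightarrow> 0\<close> for all \<open>y\<close> by controllability. Inside a generalized eigenspace for \<open>\<bar>\<mu>\<bar> \<ge> 1\<close>,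
  induction on the order of \<open>v\<close> gives \<open>f (T^n v) = \<mu>^n f v\<close>, so \<open>f v = 0\<close>: no growth estimate and no
  distinction between centre and unstable directions is needed. Conversely, the orbits of \<open>E\<^sup>s\<close> are
  summable, so the projection of \<open>R\<close> to \<open>E\<^sup>s\<close> along \<open>E\<^sup>u\<^sup>c\<close> is bounded, and \<open>K = closure R \<inter> E\<^sup>s\<close>.

  The controllable set is the reachable set of \<open>(A\<inverse>, - A\<inverse> B)\<close>, for which \<open>E\<^sup>s\<close> and \<open>E\<^sup>u\<close> are swapped.
  The real case is read off from the complexification of \<open>A\<close>.
\<close>

subsection \<open>Sets reachable under a linear map\<close>

text \<open>Time runs backwards: the input entering as \<open>T ^^ i\<close> is the one applied
  \<open>i\<close> steps before the end. Inputs are chosen freely at each time, so reversing them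
  leaves the reachable points the same, and padding with a zero input makes the sets increase with
  \<open>k\<close>.\<close>

definition reach :: "('v \<Rightarrow> 'v) \<Rightarrow> 'v set \<Rightarrow> nat \<Rightarrow> 'v::real_vector set" where
  "reach T W k = {\<Sum>i<k. (T ^^ i) (w i) | w. \<forall>i. w i \<in> W}"

lemma reachI: "(\<And>i. w i \<in> W) \<Longrightarrow> (\<Sum>i<k. (T ^^ i) (w i)) \<in> reach T W k"
  by (auto simp: reach_def)

lemma reachE:
  assumes "x \<in> reach T W k"
  obtains w where "x = (\<Sum>i<k. (T ^^ i) (w i))" "\<And>i. w i \<in> W"
  using assms by (auto simp: reach_def)

lemma linear_funpow:
  fixes T :: "'v::real_vector \<Rightarrow> 'v"
  assumes "linear T"
  shows "linear (T ^^ n)"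
proof (induction n)
  case 0
  show ?case by (simp add: linear_id[unfolded id_def] id_def)
next
  case (Suc n)
  then show ?case using assms by (simp add: linear_compose[unfolded o_def] o_def)
qed

lemma funpow_in_invariant:
  assumes "T ` X \<subseteq> X" "x \<in> X"
  shows "(T ^^ n) x \<in> X"
  using assms by (induction n) auto

lemma reach_mono_set: "W \<subseteq> W' \<Longrightarrow> reach T W k \<subseteq> reach T W' k"
  by (auto simp: reach_def)

lemma reach_subset_Suc:
  assumes "linear T" "0 \<in> W"
  shows "reach T W k \<subseteq> reach T W (Suc k)"
proof
  fix x assume "x \<in> reach T W k"
  then obtain w where w: "x = (\<Sum>i<k. (T ^^ i) (w i))" "\<And>i. w i \<in> W"
    by (auto elim!: reachE)
  have "x = (\<Sum>i<Suc k. (T ^^ i) ((w(k := 0)) i))"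
    using w(1) linear_0[OF linear_funpow[OF assms(1)]] by simp
  then show "x \<in> reach T W (Suc k)" using w assms reachI[of "w(k := 0)" W T "Suc k"] by auto
qed

lemma reach_mono:
  assumes "linear T" "0 \<in> W" "k \<le> l"
  shows "reach T W k \<subseteq> reach T W l"
  using assms lift_Suc_mono_le[of "reach T W"] reach_subset_Suc by metis

lemma convex_reach:
  assumes "linear T" "convex W"
  shows "convex (reach T W k)"
proof (rule convexI)
  fix x y :: 'a and u v :: real
  assume "x \<in> reach T W k" "y \<in> reach T W k" and uv: "0 \<le> u" "0 \<le> v" "u + v = 1"
  then obtain w z where w: "x = (\<Sum>i<k. (T ^^ i) (w i))" "\<And>i. w i \<in> W"
    and z: "y = (\<Sum>i<k. (T ^^ i) (z i))" "\<And>i. z i \<in> W"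
    by (auto elim!: reachE)
  have "u *\<^sub>R x + v *\<^sub>R y = (\<Sum>i<k. (T ^^ i) (u *\<^sub>R w i + v *\<^sub>R z i))"
    using linear_funpow[OF assms(1)]
    by (simp add: w z scaleR_sum_right sum.distrib linear_add linear_scale)
  moreover have "\<And>i. u *\<^sub>R w i + v *\<^sub>R z i \<in> W"
    using w z uv assms(2) by (auto intro: convexD)
  ultimately show "u *\<^sub>R x + v *\<^sub>R y \<in> reach T W k"
    using reachI[of "\<lambda>i. u *\<^sub>R w i + v *\<^sub>R z i"] by simp
qed

lemma convex_UN_reach:
  assumes "linear T" "convex W" "0 \<in> W"
  shows "convex (\<Union>k. reach T W k)"
proof (rule convexI)
  fix x y :: 'a and u v :: real
  assume "x \<in> (\<Union>k. reach T W k)" "y \<in> (\<Union>k. reach T W k)"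
    and uv: "0 \<le> u" "0 \<le> v" "u + v = 1"
  then obtain k l where "x \<in> reach T W k" "y \<in> reach T W l" by blast
  then have "x \<in> reach T W (max k l)" "y \<in> reach T W (max k l)"
    using reach_mono[OF assms(1,3)] by (meson in_mono max.cobounded1 max.cobounded2)+
  then show "u *\<^sub>R x + v *\<^sub>R y \<in> (\<Union>k. reach T W k)"
    using convexD[OF convex_reach[OF assms(1,2)]] uv by blast
qed

section \<open>Interior of the reachable set and functionals bounded on it\<close>

text \<open>Inputs from the symmetric part of \<open>W\<close> reach a convex symmetric set; once
  this has an interior point \<open>x\<close>, the midpoint of \<open>x\<close> and
  \<open>- x\<close> is interior too. A set without interior would lie in a hyperplane, which
  \<open>gen\<close> excludes. Here \<open>gen\<close> is controllability, phrased for the symmetric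
  part of the inputs.\<close>

lemma zero_in_interior_reach:
  fixes T :: "'v::euclidean_space \<Rightarrow> 'v"
  assumes lin: "linear T" and W: "convex W" "0 \<in> W"
    and gen: "\<And>X. subspace X \<Longrightarrow> T ` X \<subseteq> X \<Longrightarrow> {w \<in> W. - w \<in> W} \<subseteq> X \<Longrightarrow> X = UNIV"
  shows "0 \<in> interior (\<Union>k. reach T W k)"
proof -
  define W0 where "W0 = {w \<in> W. - w \<in> W}"
  define R where "R = (\<Union>k. reach T W0 k)"
  note lf = linear_funpow[OF lin]
  have sym: "- w \<in> W0" if "w \<in> W0" for w using that by (simp add: W0_def)
  have W0: "0 \<in> W0" using W by (simp add: W0_def)
  have "W0 = W \<inter> uminus ` W" by (auto simp: W0_def image_iff) (metis minus_minus)
  then have "convex W0" using W by (auto intro: convex_Int convex_negations)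
  then have cR: "convex R" unfolding R_def using lin W0 by (intro convex_UN_reach)
  have single: "(T ^^ n) w \<in> R" if "w \<in> W0" for w n
  proof -
    have "(T ^^ n) w = (\<Sum>i<Suc n. (T ^^ i) (if i = n then w else 0))"
      using linear_0[OF lf] by simp
    also have "\<dots> \<in> reach T W0 (Suc n)" using that W0 by (intro reachI) auto
    finally show ?thesis unfolding R_def by blast
  qed
  have "interior R \<noteq> {}"
  proof
    assume "interior R = {}"
    then obtain a b where ab: "a \<noteq> 0" "R \<subseteq> {x. a \<bullet> x = b}"
      using empty_interior_subset_hyperplane[OF cR] by blast
    have "0 \<in> R" using single[OF W0, of 0] by simp
    then have b: "b = 0" using ab by auto
    \<comment> \<open>The largest \<open>T\<close>-invariant subspace inside the hyperplane
      orthogonal to \<open>a\<close>. Since it contains \<open>W0\<close>, it is everything,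
      including \<open>a\<close> itself.\<close>
    define X where "X = {x. \<forall>n. a \<bullet> (T ^^ n) x = 0}"
    have "subspace X"
      using lf by (auto simp: X_def subspace_def linear_0 linear_add linear_scale inner_add_right)
    moreover have "T ` X \<subseteq> X"
    proof clarify
      fix y assume "y \<in> X"
      then have "a \<bullet> (T ^^ Suc n) y = 0" for n unfolding X_def by blast
      then show "T y \<in> X" by (simp add: X_def funpow_swap1)
    qed
    moreover have "W0 \<subseteq> X" using single ab b by (auto simp: X_def)
    ultimately have "X = UNIV" using gen by (auto simp: W0_def)
    then have "a \<in> X" by simp
    then have "a \<bullet> (T ^^ 0) a = 0" unfolding X_def by blast
    then show False using ab by simp
  qed
  then obtain x where x: "x \<in> interior R" by blast
  then have "x \<in> R" using interior_subset by blast
  then obtain k w where w: "x = (\<Sum>i<k. (T ^^ i) (w i))" "\<And>i. w i \<in> W0"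
    by (auto simp: R_def elim: reachE)
  have "- x = (\<Sum>i<k. (T ^^ i) (- w i))"
    using lf by (simp add: w linear_neg sum_negf)
  then have "- x \<in> R" using reachI[of "\<lambda>i. - w i" W0 T k] w sym R_def by auto
  from mem_interior_convex_shrink[OF cR x this, of "1/2"]
  have "- x - (1/2) *\<^sub>R (- x - x) \<in> interior R" by simp
  moreover have "- x - (1/2) *\<^sub>R (- x - x) = 0" by (simp add: vec_eq_iff euclidean_eq_iff[where 'a = 'v] inner_diff_left)
  moreover have "R \<subseteq> (\<Union>k. reach T W k)"
    unfolding R_def W0_def by (intro UN_mono reach_mono_set) auto
  ultimately show ?thesis using interior_mono[of R] by auto
qed

text \<open>The vectors whose orbits are sent to a null sequence by \<open>f\<close> form an
  invariant subspace, so by \<open>gen\<close> only the symmetric inputs have to be tested.\<close>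

lemma functional_bounded_on_reach_tendsto_0:
  fixes T :: "'v::real_vector \<Rightarrow> 'v" and f :: "'v \<Rightarrow> real"
  assumes lin: "linear T" and f: "linear f"
    and bd: "\<And>x. x \<in> (\<Union>k. reach T W k) \<Longrightarrow> f x \<le> M"
    and gen: "\<And>X. subspace X \<Longrightarrow> T ` X \<subseteq> X \<Longrightarrow> {w \<in> W. - w \<in> W} \<subseteq> X \<Longrightarrow> X = UNIV"
  shows "(\<lambda>n. f ((T ^^ n) y)) \<longlonglongrightarrow> 0"
proof -
  note lf = linear_funpow[OF lin]
  define X where "X = {y. (\<lambda>n. f ((T ^^ n) y)) \<longlonglongrightarrow> 0}"
  have "subspace X"
    using lf f by (auto simp: X_def subspace_def linear_0 linear_add linear_scale
        intro: tendsto_add_zero tendsto_mult_right_zero)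
  moreover have "T ` X \<subseteq> X"
  proof clarify
    fix y assume "y \<in> X"
    then have "(\<lambda>n. f ((T ^^ Suc n) y)) \<longlonglongrightarrow> 0"
      unfolding X_def mem_Collect_eq by (rule LIMSEQ_Suc)
    then show "T y \<in> X" by (simp add: X_def funpow_swap1)
  qed
  moreover have "{w \<in> W. - w \<in> W} \<subseteq> X"
  proof clarify
    fix w assume w: "w \<in> W" "- w \<in> W"
    \<comment> \<open>The sign of each input is chosen so that every term contributes its absolute
      value; the upper bound \<open>M\<close> then bounds all partial sums of a nonnegative
      series.\<close>
    define v where "v n = (if f ((T ^^ n) w) \<ge> 0 then w else - w)" for n
    have v: "f ((T ^^ n) (v n)) = \<bar>f ((T ^^ n) w)\<bar>" for n
      using lf f by (auto simp: v_def linear_neg)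
    have "(\<Sum>n<k. \<bar>f ((T ^^ n) w)\<bar>) \<le> M" for k
    proof -
      have "(\<Sum>n<k. (T ^^ n) (v n)) \<in> reach T W k" using w by (intro reachI) (auto simp: v_def)
      then have "f (\<Sum>n<k. (T ^^ n) (v n)) \<le> M" using bd by blast
      then show ?thesis using f v by (simp add: linear_sum)
    qed
    then have "summable (\<lambda>n. \<bar>f ((T ^^ n) w)\<bar>)"
      by (intro summableI_nonneg_bounded[where x = M]) auto
    then show "w \<in> X"
      using summable_LIMSEQ_zero tendsto_rabs_zero_iff unfolding X_def by blast
  qed
  ultimately have "X = UNIV" by (rule gen)
  then show ?thesis by (auto simp: X_def)
qed

section \<open>Closed convex sets, complementary subspaces and projections\<close>

text \<open>The point \<open>c + l\<close> is the limit, as \<open>t\<close> tends to 0, of the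
  convex combinations of \<open>c\<close> and \<open>(1 / t) *\<^sub>R l\<close>, the latter staying
  in \<open>L\<close>.\<close>

lemma convex_closed_absorbs_subspace:
  fixes C :: "'v::real_normed_vector set"
  assumes "convex C" "closed C" "subspace L" "L \<subseteq> C" "c \<in> C" "l \<in> L"
  shows "c + l \<in> C"
proof -
  \<comment> \<open>Any null sequence in the open unit interval would do; the offset 2 keeps
    \<open>t 0\<close> below 1.\<close>
  define t where "t n = 1 / (real n + 2)" for n
  have t: "0 < t n" "t n < 1" for n by (auto simp: t_def)
  have "(1 - t n) *\<^sub>R c + t n *\<^sub>R ((1 / t n) *\<^sub>R l) \<in> C" for n
    using assms t[of n] by (intro convexD) (auto intro: subspace_scale subsetD less_imp_le)
  then have *: "(1 - t n) *\<^sub>R c + l \<in> C" for n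
    using t(1)[of n] by (metis less_irrefl nonzero_eq_divide_eq scaleR_one scaleR_scaleR mult.commute)
  have "t \<longlonglongrightarrow> 0" unfolding t_def by real_asymp
  then have "(\<lambda>n. (1 - t n) *\<^sub>R c + l) \<longlonglongrightarrow> (1 - 0) *\<^sub>R c + l"
    by (intro tendsto_intros)
  then have "(1 - 0) *\<^sub>R c + l \<in> C"
    by (rule closed_sequentially[OF assms(2), rotated]) (rule *)
  then show ?thesis by simp
qed

text \<open>Trivial intersection makes the chosen \<open>S\<close>-component unique, and uniqueness
  gives linearity. The last property computes \<open>P x\<close> by exhibiting a candidate.\<close>

lemma linear_projection_exists:
  fixes S L :: "'v::real_vector set"
  assumes S: "subspace S" and L: "subspace L"
    and int: "S \<inter> L \<subseteq> {0}" and sum: "\<And>x. \<exists>s\<in>S. \<exists>l\<in>L. x = s + l"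
  obtains P where "linear P" "\<And>x. P x \<in> S" "\<And>x. x - P x \<in> L"
    "\<And>x s. s \<in> S \<Longrightarrow> x - s \<in> L \<Longrightarrow> P x = s"
proof -
  have "\<forall>x. \<exists>s. s \<in> S \<and> x - s \<in> L"
  proof
    fix x
    from sum[of x] obtain s l where "s \<in> S" "l \<in> L" "x = s + l" by blast
    then show "\<exists>s. s \<in> S \<and> x - s \<in> L" by (intro exI[of _ s]) auto
  qed
  then obtain P where P: "P x \<in> S" "x - P x \<in> L" for x by metis
  have uniq: "P x = s" if "s \<in> S" "x - s \<in> L" for x s
  proof -
    have "(x - P x) - (x - s) \<in> L" by (rule subspace_diff[OF L P(2) that(2)])
    then have "s - P x \<in> S \<inter> L" using that P S by (simp add: subspace_diff)
    then show ?thesis using int by auto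
  qed
  have "linear P"
  proof (rule linearI)
    fix x y
    have "(x - P x) + (y - P y) \<in> L" using P L by (intro subspace_add)
    then show "P (x + y) = P x + P y" using P S by (intro uniq subspace_add) (auto simp: algebra_simps)
  next
    fix c x
    have "c *\<^sub>R (x - P x) \<in> L" using P L by (intro subspace_scale)
    then show "P (c *\<^sub>R x) = c *\<^sub>R P x" using P S by (intro uniq subspace_scale) (auto simp: algebra_simps)
  qed
  then show thesis using that P uniq by blast
qed

text \<open>
  The last clause is the dual form of "no orbit in \<open>L\<close> decays", which is all that the separation
  argument needs.
\<close>

definition stable_splitting ::
    "('v::real_normed_vector \<Rightarrow> 'v) \<Rightarrow> 'v set \<Rightarrow> 'v set \<Rightarrow> bool" where
  "stable_splitting T S L \<longleftrightarrow>
     subspace S \<and> T ` S \<subseteq> S \<and> subspace L \<and> T ` L \<subseteq> L \<and> S \<inter> L \<subseteq> {0} \<and>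
     (\<forall>x. \<exists>s\<in>S. \<exists>l\<in>L. x = s + l) \<and>
     (\<forall>s\<in>S. summable (\<lambda>n. norm ((T ^^ n) s))) \<and>
     (\<forall>(f :: 'v \<Rightarrow> real) l. linear f \<longrightarrow> (\<forall>y. (\<lambda>n. f ((T ^^ n) y)) \<longlonglongrightarrow> 0) \<longrightarrow> l \<in> L \<longrightarrow> f l = 0)"

text \<open>Separation puts \<open>L\<close> into the closure of the reachable set, which is then
  invariant under translation by \<open>L\<close>. Hence its slice by \<open>S\<close> is also its
  projection to \<open>S\<close> along \<open>L\<close>; boundedness of that projection makes the
  slice compact.\<close>

theorem closure_reach_decomposition:
  fixes T :: "'v::euclidean_space \<Rightarrow> 'v"
  assumes lin: "linear T" and W: "compact W" "convex W" "0 \<in> W"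
    and gen: "\<And>X. subspace X \<Longrightarrow> T ` X \<subseteq> X \<Longrightarrow> {w \<in> W. - w \<in> W} \<subseteq> X \<Longrightarrow> X = UNIV"
    and split: "stable_splitting T S L"
  shows "\<exists>K. compact K \<and> convex K \<and> K \<subseteq> S \<and> top_of_set S interior_of K \<noteq> {} \<and>
           closure (\<Union>k. reach T W k) = K + L \<and> 0 \<in> K \<and> L \<subseteq> interior (\<Union>k. reach T W k)"
proof -
  have S: "subspace S" "T ` S \<subseteq> S" and L: "subspace L" "T ` L \<subseteq> L"
    and int: "S \<inter> L \<subseteq> {0}" and sum: "\<And>x. \<exists>s\<in>S. \<exists>l\<in>L. x = s + l"
    and summ: "\<And>s. s \<in> S \<Longrightarrow> summable (\<lambda>n. norm ((T ^^ n) s))"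
    and ann: "\<And>(f :: 'v \<Rightarrow> real) l. linear f \<Longrightarrow> (\<And>y. (\<lambda>n. f ((T ^^ n) y)) \<longlonglongrightarrow> 0)
        \<Longrightarrow> l \<in> L \<Longrightarrow> f l = 0"
    using split unfolding stable_splitting_def by blast+
  note lf = linear_funpow[OF lin]
  define R where "R = (\<Union>k. reach T W k)"
  have cR: "convex R" unfolding R_def using lin W by (intro convex_UN_reach)
  have int0: "0 \<in> interior R" unfolding R_def using zero_in_interior_reach[OF lin W(2,3) gen] by blast
  have ccl: "convex (closure R)" using cR by (rule convex_closure)
  have Lcl: "L \<subseteq> closure R"
  proof (rule ccontr)
    assume "\<not> L \<subseteq> closure R"
    then obtain z where z: "z \<in> L" "z \<notin> closure R" by blast
    obtain a b where ab: "a \<bullet> z < b" "\<forall>x\<in>closure R. a \<bullet> x > b"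
      using separating_hyperplane_closed_point[OF ccl closed_closure z(2)] by blast
    \<comment> \<open>The minus sign turns the lower bound \<open>b\<close> on the closure into an
      upper bound for \<open>f\<close>. The contradiction will be that \<open>f z = 0\<close> forces
      \<open>b > 0\<close>, while \<open>0\<close> in the closure forces
      \<open>b < 0\<close>.\<close>
    define f where "f x = - (a \<bullet> x)" for x
    have f: "linear f" by (rule linearI) (auto simp: f_def inner_add_right)
    have "f x \<le> - b" if "x \<in> R" for x
      using ab that closure_subset by (fastforce simp: f_def)
    then have "(\<lambda>n. f ((T ^^ n) y)) \<longlonglongrightarrow> 0" for y
      unfolding R_def using functional_bounded_on_reach_tendsto_0[OF lin f _ gen] by blast
    then have "f z = 0" using ann f z by blast
    moreover have "0 \<in> closure R" using int0 interior_subset closure_subset by blast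
    ultimately show False using ab by (auto simp: f_def)
  qed
  have Lint: "L \<subseteq> interior R"
  proof
    fix x assume "x \<in> L"
    \<comment> \<open>\<open>x\<close> is the midpoint of the interior point \<open>0\<close> and
      the point \<open>2 *\<^sub>R x\<close> of the closure.\<close>
    then have "2 *\<^sub>R x \<in> closure R" using L Lcl by (meson subsetD subspace_scale)
    from mem_interior_closure_convex_shrink[OF cR int0 this, of "1/2"]
    show "x \<in> interior R" by (simp add: scaleR_2)
  qed
  obtain P where P: "linear P" "\<And>x. P x \<in> S" "\<And>x. x - P x \<in> L"
    "\<And>x s. s \<in> S \<Longrightarrow> x - s \<in> L \<Longrightarrow> P x = s"
    using linear_projection_exists[OF S(1) L(1) int sum] by blast
  have PT: "P ((T ^^ n) x) = (T ^^ n) (P x)" for n x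
  proof (rule P(4))
    show "(T ^^ n) (P x) \<in> S" using S P by (intro funpow_in_invariant)
    have "(T ^^ n) x - (T ^^ n) (P x) = (T ^^ n) (x - P x)"
      using linear_diff[OF lf] by simp
    also have "\<dots> \<in> L" using L P by (intro funpow_in_invariant)
    finally show "(T ^^ n) x - (T ^^ n) (P x) \<in> L" .
  qed
  obtain c where c: "\<And>w. w \<in> W \<Longrightarrow> norm w \<le> c"
    using compact_imp_bounded[OF W(1)] unfolding bounded_iff by blast
  have c0: "0 \<le> c" using c[OF W(3)] by simp
  \<comment> \<open>The splitting gives summability orbit by orbit, without uniformity. Expanding
    each input in the basis, with coordinates of size at most \<open>c\<close>, leaves only the
    finitely many orbits of \<open>P b\<close>.\<close>
  define M where "M = (\<Sum>b\<in>Basis. c * (\<Sum>i. norm ((T ^^ i) (P b))))"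
  have bdR: "norm (P x) \<le> M" if "x \<in> R" for x
  proof -
    obtain k w where w: "x = (\<Sum>i<k. (T ^^ i) (w i))" "\<And>i. w i \<in> W"
      using \<open>x \<in> R\<close> by (auto simp: R_def elim: reachE)
    have "norm ((T ^^ i) (P (w i))) \<le> (\<Sum>b\<in>Basis. c * norm ((T ^^ i) (P b)))" for i
    proof -
      have "(T ^^ i) (P (w i)) = (T ^^ i) (P (\<Sum>b\<in>Basis. (w i \<bullet> b) *\<^sub>R b))"
        by (simp add: euclidean_representation)
      also have "\<dots> = (\<Sum>b\<in>Basis. (w i \<bullet> b) *\<^sub>R (T ^^ i) (P b))"
        using lf P(1) by (simp add: linear_sum linear_scale)
      also have "norm \<dots> \<le> (\<Sum>b\<in>Basis. \<bar>w i \<bullet> b\<bar> * norm ((T ^^ i) (P b)))"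
        by (rule order.trans[OF norm_sum]) simp
      also have "\<dots> \<le> (\<Sum>b\<in>Basis. c * norm ((T ^^ i) (P b)))"
        using c[OF w(2)[of i]]
        by (intro sum_mono mult_right_mono) (auto intro: order.trans[OF Basis_le_norm])
      finally show ?thesis .
    qed
    then have "norm (P x) \<le> (\<Sum>i<k. \<Sum>b\<in>Basis. c * norm ((T ^^ i) (P b)))"
      using P(1) by (auto simp: w linear_sum PT intro!: sum_norm_le)
    also have "\<dots> = (\<Sum>b\<in>Basis. c * (\<Sum>i<k. norm ((T ^^ i) (P b))))"
      by (subst sum.swap) (simp add: sum_distrib_left)
    also have "\<dots> \<le> M" unfolding M_def
      using c0 P(2) by (intro sum_mono mult_left_mono sum_le_suminf summ) auto
    finally show ?thesis .
  qed
  define K where "K = closure R \<inter> S"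
  \<comment> \<open>The bound passes to the closure because the preimage of a closed ball under
    \<open>P\<close> is closed; on \<open>S\<close>, where \<open>P\<close> is the identity, it
    bounds \<open>K\<close>.\<close>
  have "closure R \<subseteq> P -` cball 0 M"
  proof (rule closure_minimal)
    show "R \<subseteq> P -` cball 0 M" using bdR by auto
    have "continuous_on UNIV P" using P(1) by (simp add: linear_continuous_on linear_linear)
    then show "closed (P -` cball 0 M)" using closed_vimage by blast
  qed
  moreover have "P x = x" if "x \<in> S" for x using P(4)[OF that, of x] subspace_0[OF L(1)] by simp
  ultimately have "K \<subseteq> cball 0 M" unfolding K_def by force
  then have "bounded K" using bounded_cball bounded_subset by blast
  moreover have "closed K" unfolding K_def by (intro closed_Int closed_closure closed_subspace[OF S(1)])
  ultimately have "compact K" by (simp add: compact_eq_bounded_closed)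
  moreover have "convex K" unfolding K_def using ccl S(1) by (intro convex_Int subspace_imp_convex[of S])
  moreover have "top_of_set S interior_of K \<noteq> {}"
  proof -
    have "openin (top_of_set S) (S \<inter> interior R)" by (simp add: openin_open_Int)
    moreover have "S \<inter> interior R \<subseteq> K"
      unfolding K_def using interior_subset closure_subset by blast
    ultimately have "S \<inter> interior R \<subseteq> top_of_set S interior_of K" by (simp add: interior_of_maximal)
    then show ?thesis using int0 subspace_0[OF S(1)] by blast
  qed
  moreover have "closure R = K + L"
  proof (intro equalityI subsetI)
    fix x assume x: "x \<in> closure R"
    \<comment> \<open>Translation by the element \<open>- (x - P x)\<close> of \<open>L\<close>
      moves \<open>x\<close> to \<open>P x\<close> inside the closure.\<close>
    have "x + (- (x - P x)) \<in> closure R"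
      by (rule convex_closed_absorbs_subspace[OF ccl closed_closure L(1) Lcl x])
        (rule subspace_neg[OF L(1) P(3)])
    then have "P x \<in> K" using P(2) by (simp add: K_def)
    then have "P x + (x - P x) \<in> K + L" using P(3) by (rule set_plus_intro)
    then show "x \<in> K + L" by simp
  next
    fix x assume "x \<in> K + L"
    then show "x \<in> closure R"
      using convex_closed_absorbs_subspace[OF ccl closed_closure L(1) Lcl]
      by (auto simp: K_def elim!: set_plus_elim)
  qed
  moreover have "0 \<in> K"
    using int0 interior_subset closure_subset subspace_0[OF S(1)] by (auto simp: K_def)
  moreover have "K \<subseteq> S" by (simp add: K_def)
  ultimately show ?thesis using Lint unfolding R_def[symmetric] by blast
qed

subsection \<open>Generalized eigenspaces of complex matrices\<close>

lemma norm_vector_smult: "norm (c *s x) = cmod c * norm (x :: complex^'n)"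
  by (simp add: norm_vec_def norm_mult L2_set_right_distrib)

lemma scaleR_eq_smult: "r *\<^sub>R x = of_real r *s (x :: 'k::real_normed_field^'n)"
  unfolding vec_eq_iff vector_scaleR_component vector_smult_component
  by (simp add: scaleR_conv_of_real)

lemma subspace_if_vec_subspace:
  "vec.subspace (S :: ('k::real_normed_field^'n) set) \<Longrightarrow> subspace S"
  by (auto simp: subspace_def vec.subspace_def scaleR_eq_smult)

lemma funpow_matrix_add:
  fixes A :: "'k::field^'n^'n"
  shows "((*v) A ^^ n) (x + y) = ((*v) A ^^ n) x + ((*v) A ^^ n) (y)"
  by (induction n) (auto simp: matrix_vector_right_distrib)

lemma funpow_matrix_smult:
  fixes A :: "'k::field^'n^'n"
  shows "((*v) A ^^ n) (c *s x) = c *s ((*v) A ^^ n) (x)"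
  by (induction n) (auto simp: vec.scale)

lemma funpow_matrix_0:
  fixes A :: "'k::field^'n^'n"
  shows "((*v) A ^^ n) (0) = 0"
  by (induction n) auto

lemma funpow_matrix_diff:
  fixes A :: "'k::field^'n^'n"
  shows "((*v) A ^^ n) (x - y) = ((*v) A ^^ n) x - ((*v) A ^^ n) (y)"
  by (induction n) (auto simp: vec.diff)

section \<open>The map \<open>A - \<mu> I\<close> and its iterates\<close>

definition shift :: "'k::field^'d^'d \<Rightarrow> 'k \<Rightarrow> 'k^'d \<Rightarrow> 'k^'d" where
  "shift A \<mu> w = A *v w - \<mu> *s w"

lemma shift_add: "shift A \<mu> (x + y) = shift A \<mu> x + shift A \<mu> y"
  by (simp add: shift_def matrix_vector_right_distrib vec.scale_right_distrib)

lemma shift_diff: "shift A \<mu> (x - y) = shift A \<mu> x - shift A \<mu> y"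
  by (simp add: shift_def vec.diff vec.scale_right_diff_distrib)

lemma shift_smult: "shift A \<mu> (c *s x) = c *s shift A \<mu> x"
  by (simp add: shift_def vec.scale vec.scale_right_diff_distrib vec.scale_left_commute)

lemma shift_0 [simp]: "shift A \<mu> 0 = 0"
  by (simp add: shift_def)

lemma shift_matrix: "shift A \<mu> (A *v x) = A *v shift A \<mu> x"
  by (simp add: shift_def vec.diff vec.scale)

lemma shift_commute: "shift A \<mu> (shift A \<nu> x) = shift A \<nu> (shift A \<mu> x)"
  by (simp add: shift_def[of A \<nu>] shift_diff shift_smult shift_matrix)

lemma gen_eigenspace_shift: "gen_eigenspace A \<mu> = {v. \<exists>n. (shift A \<mu> ^^ n) v = 0}"
  unfolding gen_eigenspace_def shift_def[abs_def] ..

lemma funpow_shift_add: "(shift A \<mu> ^^ n) (x + y) = (shift A \<mu> ^^ n) x + (shift A \<mu> ^^ n) y"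
  by (induction n) (auto simp: shift_add)

lemma funpow_shift_smult: "(shift A \<mu> ^^ n) (c *s x) = c *s (shift A \<mu> ^^ n) x"
  by (induction n) (auto simp: shift_smult)

lemma funpow_shift_0 [simp]: "(shift A \<mu> ^^ n) 0 = 0"
  by (induction n) auto

lemma funpow_shift_matrix: "(shift A \<mu> ^^ n) (A *v x) = A *v (shift A \<mu> ^^ n) x"
  by (induction n) (auto simp: shift_matrix)

lemma subspace_gen_eigenspace: "vec.subspace (gen_eigenspace A \<mu>)"
proof (rule vec.subspaceI)
  show "0 \<in> gen_eigenspace A \<mu>" by (simp add: gen_eigenspace_shift)
next
  fix x y assume "x \<in> gen_eigenspace A \<mu>" "y \<in> gen_eigenspace A \<mu>"
  then obtain n m where nm: "(shift A \<mu> ^^ n) x = 0" "(shift A \<mu> ^^ m) y = 0"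
    by (auto simp: gen_eigenspace_shift)
  have "(shift A \<mu> ^^ (m + n)) x = 0" using nm by (simp add: funpow_add)
  moreover have "(shift A \<mu> ^^ (n + m)) y = 0" using nm by (simp add: funpow_add)
  ultimately have "(shift A \<mu> ^^ (m + n)) (x + y) = 0"
    by (simp add: funpow_shift_add add.commute)
  then show "x + y \<in> gen_eigenspace A \<mu>" unfolding gen_eigenspace_shift by blast
next
  fix c x assume "x \<in> gen_eigenspace A \<mu>"
  then show "c *s x \<in> gen_eigenspace A \<mu>"
    by (auto simp: gen_eigenspace_shift funpow_shift_smult)
qed

lemma gen_eigenspace_matrix: "v \<in> gen_eigenspace A \<mu> \<Longrightarrow> A *v v \<in> gen_eigenspace A \<mu>"
  unfolding gen_eigenspace_shift mem_Collect_eq funpow_shift_matrix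
  by (metis matrix_vector_mult_0_right)

lemma gen_eigenspaceI: "shift A \<mu> v \<in> gen_eigenspace A \<mu> \<Longrightarrow> v \<in> gen_eigenspace A \<mu>"
  unfolding gen_eigenspace_shift by (auto simp: funpow_swap1 intro: exI[of _ "Suc n" for n])

text \<open>Induction on an exponent killing \<open>v\<close>, which drops by one under
  \<open>shift A \<mu>\<close>. It keeps exponents out of the later arguments on generalized
  eigenvectors.\<close>

lemma gen_eigenspace_induct [consumes 1, case_names zero shift]:
  assumes "v \<in> gen_eigenspace A \<mu>" and "P 0"
    and step: "\<And>v. v \<in> gen_eigenspace A \<mu> \<Longrightarrow> P (shift A \<mu> v) \<Longrightarrow> P v"
  shows "P v"
proof -
  from assms(1) obtain n where "(shift A \<mu> ^^ n) v = 0" by (auto simp: gen_eigenspace_shift)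
  then show ?thesis
  proof (induction n arbitrary: v)
    case 0
    then show ?case using assms(2) by simp
  next
    case (Suc n)
    from Suc.prems have "(shift A \<mu> ^^ n) (shift A \<mu> v) = 0" by (simp add: funpow_swap1)
    then have "P (shift A \<mu> v)" by (rule Suc.IH)
    moreover have "v \<in> gen_eigenspace A \<mu>" using Suc.prems unfolding gen_eigenspace_shift by blast
    ultimately show ?case using step by blast
  qed
qed

lemma gen_eigenspace_trivial:
  assumes "\<mu> \<notin> eigenvalues A" "v \<in> gen_eigenspace A \<mu>"
  shows "v = 0"
  using assms(2)
proof (induction rule: gen_eigenspace_induct)
  case (shift v)
  then show ?case using assms(1) by (auto simp: eigenvalues_def shift_def)
qed simp

section \<open>Generalized eigenvectors span the complex space\<close>

text \<open>On this space \<open>shift A \<nu>\<close> is the locally nilpotent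
  \<open>shift A \<mu>\<close> plus the nonzero scalar \<open>\<mu> - \<nu>\<close>, hence
  invertible.\<close>

lemma shift_surj_on_gen_eigenspace:
  assumes "y \<in> gen_eigenspace A \<mu>" "\<mu> \<noteq> \<nu>"
  shows "\<exists>x\<in>gen_eigenspace A \<mu>. shift A \<nu> x = y"
  using assms(1)
proof (induction rule: gen_eigenspace_induct)
  case zero
  show ?case using vec.subspace_0[OF subspace_gen_eigenspace] by force
next
  case (shift y)
  then obtain z where z: "z \<in> gen_eigenspace A \<mu>" "shift A \<nu> z = shift A \<mu> y" by blast
  \<comment> \<open>From \<open>shift A \<nu> y = shift A \<mu> y + (\<mu> - \<nu>) *s y\<close>,
    subtracting the preimage \<open>z\<close> of \<open>shift A \<mu> y\<close> leaves a multiple of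
    \<open>y\<close>.\<close>
  let ?x = "(1 / (\<mu> - \<nu>)) *s (y - z)"
  have sh: "shift A \<nu> (y - z) = (\<mu> - \<nu>) *s y"
    unfolding shift_diff z(2) by (simp add: shift_def vec.scale_left_diff_distrib)
  have "shift A \<nu> ?x = (1 / (\<mu> - \<nu>) * (\<mu> - \<nu>)) *s y"
    by (simp only: shift_smult sh vec.scale_scale)
  then have "shift A \<nu> ?x = y" using assms(2) by simp
  moreover have "?x \<in> gen_eigenspace A \<mu>"
    using z(1) shift.hyps
    by (intro vec.subspace_scale vec.subspace_diff subspace_gen_eigenspace)
  ultimately show ?case by blast
qed

text \<open>A generator for \<open>\<mu> \<noteq> \<nu>\<close> lies in the image of
  \<open>shift A \<nu>\<close>; a generator for \<open>\<nu>\<close> serves as \<open>g\<close>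
  itself.\<close>

lemma span_gen_eigenspaces_decompose:
  assumes "y \<in> vec.span (\<Union>\<mu>. gen_eigenspace A \<mu>)" (is "_ \<in> ?S")
  shows "\<exists>x\<in>?S. \<exists>g\<in>gen_eigenspace A \<nu>. y = shift A \<nu> x + g"
  using assms
proof (rule vec.span_induct)
  show "vec.subspace {y. \<exists>x\<in>?S. \<exists>g\<in>gen_eigenspace A \<nu>. y = shift A \<nu> x + g}"
  proof (rule vec.subspaceI, goal_cases)
    case 1
    show ?case
      using vec.span_zero vec.subspace_0[OF subspace_gen_eigenspace] by force
  next
    case (2 y z)
    then obtain x g x' g' where
      "x \<in> ?S" "x' \<in> ?S" "g \<in> gen_eigenspace A \<nu>" "g' \<in> gen_eigenspace A \<nu>"
      "y = shift A \<nu> x + g" "z = shift A \<nu> x' + g'" by blast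
    then show ?case
      by (intro CollectI bexI[of _ "x + x'"] bexI[of _ "g + g'"])
        (auto simp: shift_add intro: vec.span_add vec.subspace_add subspace_gen_eigenspace)
  next
    case (3 c y)
    then obtain x g where "x \<in> ?S" "g \<in> gen_eigenspace A \<nu>" "y = shift A \<nu> x + g" by blast
    then show ?case
      by (intro CollectI bexI[of _ "c *s x"] bexI[of _ "c *s g"])
        (auto simp: shift_smult vec.scale_right_distrib
          intro: vec.span_scale vec.subspace_scale subspace_gen_eigenspace)
  qed
next
  fix y assume "y \<in> (\<Union>\<mu>. gen_eigenspace A \<mu>)"
  then obtain \<mu> where \<mu>: "y \<in> gen_eigenspace A \<mu>" by blast
  show "\<exists>x\<in>?S. \<exists>g\<in>gen_eigenspace A \<nu>. y = shift A \<nu> x + g"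
  proof (cases "\<mu> = \<nu>")
    case True
    then show ?thesis using \<mu> vec.span_zero by force
  next
    case False
    then obtain x where x: "x \<in> gen_eigenspace A \<mu>" "shift A \<nu> x = y"
      using shift_surj_on_gen_eigenspace[OF \<mu>] by blast
    then have "x \<in> ?S" by (intro vec.span_base) blast
    then show ?thesis using x vec.subspace_0[OF subspace_gen_eigenspace] by force
  qed
qed

text \<open>Injectivity of \<open>A - \<nu> I\<close> modulo the span: \<open>x\<close> differs from
  a vector \<open>z\<close> of the span by a generalized eigenvector for \<open>\<nu>\<close>. This
  cancels one linear factor of a polynomial in \<open>A\<close>.\<close>

lemma shift_in_span_gen_eigenspacesD:
  assumes "shift A \<nu> x \<in> vec.span (\<Union>\<mu>. gen_eigenspace A \<mu>)" (is "_ \<in> ?S")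
  shows "x \<in> ?S"
proof -
  obtain z g where z: "z \<in> ?S" "g \<in> gen_eigenspace A \<nu>" "shift A \<nu> x = shift A \<nu> z + g"
    using span_gen_eigenspaces_decompose[OF assms] by blast
  then have "shift A \<nu> (x - z) \<in> gen_eigenspace A \<nu>" by (simp add: shift_diff)
  then have "x - z \<in> gen_eigenspace A \<nu>" by (rule gen_eigenspaceI)
  then have "x - z \<in> ?S" by (intro vec.span_base) blast
  then have "(x - z) + z \<in> ?S" using z(1) by (rule vec.span_add)
  then show ?thesis by simp
qed

text \<open>Over the complex numbers \<open>p\<close> splits into linear factors, and these are
  cancelled one at a time. The sum is \<open>p(A) x\<close>, written with any number
  \<open>n\<close> of terms above the degree.\<close>

lemma poly_in_span_gen_eigenspacesD:
  fixes A :: "complex^'d^'d"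
  assumes "p \<noteq> 0" "degree p < n"
    and "(\<Sum>i<n. coeff p i *s ((*v) A ^^ i) x) \<in> vec.span (\<Union>\<mu>. gen_eigenspace A \<mu>)" (is "_ \<in> ?S")
  shows "x \<in> ?S"
  using assms
proof (induction n arbitrary: p)
  case 0
  then show ?case by simp
next
  case (Suc n)
  show ?case
  proof (cases "degree p = 0")
    case True
    then obtain a where a: "p = [:a:]" by (auto elim: degree_eq_zeroE)
    then have "a *s x \<in> ?S" using Suc.prems(3)
      by (simp add: sum.lessThan_Suc_shift coeff_pCons del: sum.lessThan_Suc)
    then have "(1 / a) *s (a *s x) \<in> ?S" by (rule vec.span_scale)
    then show ?thesis using a Suc.prems(1) by simp
  next
    case False
    then obtain \<nu> where "poly p \<nu> = 0"
      using fundamental_theorem_of_algebra[of p] constant_degree[of p] by auto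
    then obtain q where q: "p = [:- \<nu>, 1:] * q" by (auto simp: poly_eq_0_iff_dvd elim: dvdE)
    with Suc.prems(1) have q0: "q \<noteq> 0" by auto
    then have "degree p = Suc (degree q)" unfolding q by (subst degree_mult_eq) auto
    then have dq: "degree q < n" using Suc.prems(2) by simp
    \<comment> \<open>With \<open>y = q(A) x\<close>, the factorization of \<open>p\<close> reads
      \<open>p(A) x = A y - \<nu> y\<close>, that is \<open>shift A \<nu> y\<close>.\<close>
    define y where "y = (\<Sum>i<n. coeff q i *s ((*v) A ^^ i) x)"
    have p: "coeff p i = coeff (pCons 0 q) i - \<nu> * coeff q i" for i
      by (simp add: q)
    have "(\<Sum>i<Suc n. coeff p i *s ((*v) A ^^ i) x)
        = (\<Sum>i<Suc n. coeff (pCons 0 q) i *s ((*v) A ^^ i) x)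
          - \<nu> *s (\<Sum>i<Suc n. coeff q i *s ((*v) A ^^ i) x)"
      by (simp only: p vec.scale_left_diff_distrib sum_subtractf vec.scale_sum_right vec.scale_scale)
    also have "(\<Sum>i<Suc n. coeff q i *s ((*v) A ^^ i) x) = y"
      using dq by (simp add: y_def coeff_eq_0)
    also have "(\<Sum>i<Suc n. coeff (pCons 0 q) i *s ((*v) A ^^ i) x) = A *v y"
      by (simp add: sum.lessThan_Suc_shift y_def vec.sum vec.scale del: sum.lessThan_Suc)
    finally have "shift A \<nu> y \<in> ?S" using Suc.prems(3) by (simp add: shift_def)
    then have "y \<in> ?S" by (rule shift_in_span_gen_eigenspacesD)
    then show ?thesis using Suc.IH[OF q0 dq] by (simp add: y_def)
  qed
qed

text \<open>In dimension \<open>d\<close> the \<open>d + 1\<close> vectors \<open>x\<close>,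
  \<open>A x\<close>, ..., \<open>A^d x\<close> are linearly dependent. The polynomial may depend on
  \<open>x\<close>.\<close>

lemma annihilating_poly_exists:
  fixes A :: "'k::field^'d^'d"
  obtains p n where "p \<noteq> 0" "degree p < n" "(\<Sum>i<n. coeff p i *s ((*v) A ^^ i) x) = 0"
proof -
  define n where "n = Suc CARD('d)"
  define g where "g i = ((*v) A ^^ i) x" for i
  obtain c j where c: "j < n" "c j \<noteq> 0" "(\<Sum>i<n. c i *s g i) = 0"
  \<comment> \<open>Dependence is a property of sets, so a repeated iterate is treated apart, with
    coefficients 1 and -1 at the two equal indices.\<close>
  proof (cases "inj_on g {..<n}")
    case True
    then have "card (g ` {..<n}) > vec.dim (UNIV :: ('k^'d) set)"
      by (simp add: card_image n_def vec_dim_card del: vec.dim_UNIV)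
    then have "vec.dependent (g ` {..<n})"
      using vec.independent_card_le_dim[of "g ` {..<n}" UNIV] by force
    then obtain u v where "v \<in> g ` {..<n}" "u v \<noteq> 0" "(\<Sum>v\<in>g ` {..<n}. u v *s v) = 0"
      by (auto simp: vec.dependent_finite)
    then show thesis using that[of _ "u \<circ> g"] by (auto simp: sum.reindex[OF True])
  next
    case False
    then obtain i j where ij: "i < n" "j < n" "i \<noteq> j" "g i = g j" by (auto simp: inj_on_def)
    have "(\<Sum>k<n. (of_bool (k = i) - of_bool (k = j)) *s g k)
        = (\<Sum>k<n. of_bool (k = i) *s g k) - (\<Sum>k<n. of_bool (k = j) *s g k)"
      by (simp only: vec.scale_left_diff_distrib sum_subtractf)
    also have "(\<Sum>k<n. of_bool (k = l) *s g k) = g l" if "l < n" for l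
    proof -
      have "(\<Sum>k<n. of_bool (k = l) *s g k) = (\<Sum>k<n. if k = l then g k else 0)"
        by (intro sum.cong) auto
      then show ?thesis using that by simp
    qed
    note this[OF ij(1)] also note \<open>\<And>l. l < n \<Longrightarrow> (\<Sum>k<n. of_bool (k = l) *s g k) = g l\<close>[OF ij(2)]
    finally show thesis using ij that[of i "\<lambda>k. of_bool (k = i) - of_bool (k = j)"] by simp
  qed
  define p where "p = (\<Sum>i<n. monom (c i) i)"
  have p: "coeff p i = (if i < n then c i else 0)" for i
    by (simp add: p_def coeff_sum)
  have "p \<noteq> 0" using p[of j] c by auto
  moreover have "degree p < n" using c(1) by (intro degree_lessI) (auto simp: p)
  moreover have "(\<Sum>i<n. coeff p i *s ((*v) A ^^ i) x) = 0"
    using c(3) by (simp add: p g_def)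
  ultimately show thesis using that by blast
qed

lemma span_gen_eigenspaces: "vec.span (\<Union>\<mu>. gen_eigenspace (A :: complex^'d^'d) \<mu>) = UNIV"
proof -
  have "x \<in> vec.span (\<Union>\<mu>. gen_eigenspace A \<mu>)" for x
    by (rule annihilating_poly_exists[of A x], rule poly_in_span_gen_eigenspacesD)
      (auto simp: vec.span_zero)
  then show ?thesis by blast
qed

section \<open>Spectral sums over sets of complex numbers\<close>

lemma spectral_sum_complex_altdef:
  "spectral_sum_complex A P = vec.span (\<Union>\<mu>\<in>P. gen_eigenspace A \<mu>)"
proof -
  have "(\<Union>\<mu>\<in>P. gen_eigenspace A \<mu>) \<subseteq> insert 0 (\<Union>\<mu>\<in>eigenvalues A \<inter> P. gen_eigenspace A \<mu>)"
    using gen_eigenspace_trivial by fastforce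
  from vec.span_mono[OF this]
  have "vec.span (\<Union>\<mu>\<in>P. gen_eigenspace A \<mu>) \<subseteq> spectral_sum_complex A P"
    by (simp add: vec.span_insert_0 spectral_sum_complex_def)
  moreover have "spectral_sum_complex A P \<subseteq> vec.span (\<Union>\<mu>\<in>P. gen_eigenspace A \<mu>)"
    unfolding spectral_sum_complex_def by (intro vec.span_mono) auto
  ultimately show ?thesis by simp
qed

lemma spectral_sum_complex_Un:
  "spectral_sum_complex A P + spectral_sum_complex A Q = spectral_sum_complex A (P \<union> Q)"
  unfolding spectral_sum_complex_altdef by (auto simp: vec.span_Un set_plus_def)

lemma spectral_sum_complex_UNIV: "spectral_sum_complex A UNIV = UNIV"
  by (simp add: spectral_sum_complex_altdef span_gen_eigenspaces)

lemma subspace_spectral_sum_complex: "vec.subspace (spectral_sum_complex A P)"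
  by (simp add: spectral_sum_complex_def)

lemma spectral_sum_complex_induct [consumes 1, case_names zero add smult gen]:
  assumes "v \<in> spectral_sum_complex A P" and "Q 0"
    and "\<And>x y. Q x \<Longrightarrow> Q y \<Longrightarrow> Q (x + y)" and "\<And>c x. Q x \<Longrightarrow> Q (c *s x)"
    and "\<And>\<mu> x. \<mu> \<in> P \<Longrightarrow> x \<in> gen_eigenspace A \<mu> \<Longrightarrow> Q x"
  shows "Q v"
proof -
  have "v \<in> vec.span (\<Union>\<mu>\<in>P. gen_eigenspace A \<mu>)"
    using assms(1) by (simp add: spectral_sum_complex_altdef)
  then show ?thesis
    by (rule vec.span_induct) (use assms in \<open>auto intro: vec.subspaceI\<close>)
qed

lemma spectral_sum_complex_base:
  "\<mu> \<in> P \<Longrightarrow> x \<in> gen_eigenspace A \<mu> \<Longrightarrow> x \<in> spectral_sum_complex A P"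
  unfolding spectral_sum_complex_altdef by (intro vec.span_base) blast

lemma spectral_sum_complex_matrix:
  assumes "v \<in> spectral_sum_complex A P"
  shows "A *v v \<in> spectral_sum_complex A P"
  using assms
proof (induction rule: spectral_sum_complex_induct)
  case (gen \<mu> x)
  then show ?case by (intro spectral_sum_complex_base gen_eigenspace_matrix)
qed (auto simp: matrix_vector_right_distrib vec.scale subspace_spectral_sum_complex
    intro: vec.subspace_0 vec.subspace_add vec.subspace_scale)

section \<open>Decay and non-decay of orbits\<close>

lemma summable_if_contracting:
  fixes a b :: "nat \<Rightarrow> real"
  assumes a: "\<And>n. 0 \<le> a n" and b: "\<And>n. 0 \<le> b n" "summable b" and q: "q < 1"
    and step: "\<And>n. a (Suc n) \<le> q * a n + b n" and q0: "0 \<le> q"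
  shows "summable a"
proof -
  \<comment> \<open>The solution of \<open>M = a 0 + q * M + suminf b\<close>, hence a bound that
    the recursion for the partial sums preserves.\<close>
  let ?M = "(a 0 + suminf b) / (1 - q)"
  have "(\<Sum>n<N. a n) \<le> ?M" for N
  proof (induction N)
    case 0
    show ?case using a[of 0] q suminf_nonneg[OF b(2,1)] by simp
  next
    case (Suc N)
    have "(\<Sum>n<Suc N. a n) = a 0 + (\<Sum>n<N. a (Suc n))" by (rule sum.lessThan_Suc_shift)
    also have "\<dots> \<le> a 0 + (\<Sum>n<N. q * a n + b n)" using step by (simp add: sum_mono)
    also have "\<dots> = a 0 + q * (\<Sum>n<N. a n) + (\<Sum>n<N. b n)"
      by (simp add: sum.distrib sum_distrib_left)
    also have "\<dots> \<le> a 0 + q * ?M + suminf b"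
      using Suc q0 b by (intro add_mono mult_left_mono sum_le_suminf) auto
    also have "\<dots> = ?M" using q by (simp add: field_simps)
    finally show ?case .
  qed
  then show ?thesis using a by (intro summableI_nonneg_bounded) auto
qed

lemma funpow_shift_split:
  "((*v) A ^^ n) (shift A \<mu> v) = ((*v) A ^^ Suc n) v - \<mu> *s ((*v) A ^^ n) v"
  by (simp add: shift_def funpow_matrix_diff funpow_matrix_smult funpow_swap1)

text \<open>For a generalized eigenvector, \<open>A^(n+1) v\<close> is \<open>\<mu>\<close> times
  \<open>A^n v\<close> plus the orbit of \<open>shift A \<mu> v\<close>, summable by induction. So
  the norms contract with factor \<open>cmod \<mu> < 1\<close> up to a summable error.\<close>

lemma summable_norm_stable:
  fixes A :: "complex^'d^'d"
  assumes "v \<in> spectral_sum_complex A {\<mu>. cmod \<mu> < 1}"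
  shows "summable (\<lambda>n. norm (((*v) A ^^ n) v))"
  using assms
proof (induction rule: spectral_sum_complex_induct)
  case zero
  show ?case by (simp add: funpow_matrix_0)
next
  case (add x y)
  then have "summable (\<lambda>n. norm (((*v) A ^^ n) x) + norm (((*v) A ^^ n) y))"
    by (rule summable_add)
  then show ?case
    by (rule summable_comparison_test') (simp add: funpow_matrix_add norm_triangle_ineq)
next
  case (smult c x)
  then show ?case by (simp add: funpow_matrix_smult norm_vector_smult summable_mult)
next
  case (gen \<mu> v)
  from gen(2) show ?case
  proof (induction rule: gen_eigenspace_induct)
    case zero
    show ?case by (simp add: funpow_matrix_0)
  next
    case (shift v)
    show ?case
    proof (rule summable_if_contracting[OF _ _ shift.IH])
      fix n
      have "((*v) A ^^ Suc n) v = \<mu> *s ((*v) A ^^ n) v + ((*v) A ^^ n) (shift A \<mu> v)"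
        by (simp only: funpow_shift_split) simp
      then show "norm (((*v) A ^^ Suc n) v)
          \<le> cmod \<mu> * norm (((*v) A ^^ n) v) + norm (((*v) A ^^ n) (shift A \<mu> v))"
        by (metis norm_triangle_ineq norm_vector_smult)
    qed (use gen in auto)
  qed
qed

lemma power_mult_tendsto_0D:
  fixes z \<mu> :: complex
  assumes "(\<lambda>n. \<mu> ^ n * z) \<longlonglongrightarrow> 0" "cmod \<mu> \<ge> 1"
  shows "z = 0"
proof -
  have "(\<lambda>n. cmod (\<mu> ^ n * z)) \<longlonglongrightarrow> 0" using assms(1) tendsto_norm_zero by blast
  moreover have "cmod z \<le> cmod (\<mu> ^ n * z)" for n
    using assms(2) mult_right_mono[of 1 "cmod \<mu> ^ n" "cmod z"] by (simp add: norm_mult norm_power one_le_power)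
  ultimately have "cmod z \<le> 0" by (intro LIMSEQ_le_const) auto
  then show ?thesis by simp
qed

lemma functional_vanishes_unstable:
  fixes A :: "complex^'d^'d" and F :: "complex^'d \<Rightarrow> complex"
  assumes F: "\<And>x y. F (x + y) = F x + F y" "\<And>c x. F (c *s x) = c * F x"
    and lim: "\<And>y. (\<lambda>n. F (((*v) A ^^ n) y)) \<longlonglongrightarrow> 0"
    and "v \<in> spectral_sum_complex A {\<mu>. cmod \<mu> \<ge> 1}"
  shows "F v = 0"
  using assms(4)
proof (induction rule: spectral_sum_complex_induct)
  case (gen \<mu> v)
  have F0: "F 0 = 0" using F(2)[of 0 0] by simp
  \<comment> \<open>Stated for all \<open>n\<close> because the induction step needs
    \<open>F\<close> to vanish along the whole orbit of \<open>shift A \<mu> v\<close>.\<close>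
  have "\<forall>n. F (((*v) A ^^ n) v) = 0"
    using gen(2)
  proof (induction rule: gen_eigenspace_induct)
    case zero
    show ?case by (simp add: funpow_matrix_0 F0)
  next
    case (shift v)
    have step: "F (((*v) A ^^ Suc n) v) = \<mu> * F (((*v) A ^^ n) v)" for n
    proof -
      have "((*v) A ^^ Suc n) v = \<mu> *s ((*v) A ^^ n) v + ((*v) A ^^ n) (shift A \<mu> v)"
        by (simp only: funpow_shift_split) simp
      then show ?thesis using shift.IH F by simp
    qed
    have pow: "F (((*v) A ^^ n) v) = \<mu> ^ n * F v" for n
    proof (induction n)
      case (Suc n)
      then show ?case using step[of n] by simp
    qed simp
    have "F v = 0" using lim[of v] gen(1) unfolding pow by (auto dest: power_mult_tendsto_0D)
    then show ?case by (simp add: pow)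
  qed
  then have "F (((*v) A ^^ 0) v) = 0" by blast
  then show ?case by simp
qed (use F F(2)[of 0 0] in auto)

lemma fold_shift_0: "fold (shift A) ms 0 = 0"
  by (induction ms) auto

lemma fold_shift_add: "fold (shift A) ms (x + y) = fold (shift A) ms x + fold (shift A) ms y"
  by (induction ms arbitrary: x y) (auto simp: shift_add)

lemma fold_shift_smult: "fold (shift A) ms (c *s x) = c *s fold (shift A) ms x"
  by (induction ms arbitrary: x) (auto simp: shift_smult)

lemma fold_shift_shift: "fold (shift A) ms (shift A \<mu> x) = shift A \<mu> (fold (shift A) ms x)"
  by (induction ms arbitrary: x) (auto simp: shift_commute[of A _ \<mu>])

lemma fold_shift_commute:
  "fold (shift A) ms (fold (shift A) ms' x) = fold (shift A) ms' (fold (shift A) ms x)"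
  by (induction ms arbitrary: x) (auto simp: fold_shift_shift)

text \<open>The list holds the roots, with repetition, of a polynomial in \<open>A\<close> that
  kills \<open>v\<close>. For a sum of two vectors the lists are concatenated, the factors being
  commuting.\<close>

lemma spectral_sum_annihilated:
  assumes "v \<in> spectral_sum_complex A P"
  shows "\<exists>ms. set ms \<subseteq> P \<and> fold (shift A) ms v = 0"
  using assms
proof (induction rule: spectral_sum_complex_induct)
  case zero
  show ?case by (intro exI[of _ "[]"]) auto
next
  case (add x y)
  then obtain ms ms' where "set ms \<subseteq> P" "fold (shift A) ms x = 0"
    "set ms' \<subseteq> P" "fold (shift A) ms' y = 0" by blast
  then have "set (ms @ ms') \<subseteq> P \<and> fold (shift A) (ms @ ms') (x + y) = 0"
    by (simp add: fold_shift_add fold_shift_0 fold_shift_commute[of A ms' ms])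
  then show ?case by blast
next
  case (smult c x)
  then show ?case by (auto simp: fold_shift_smult)
next
  case (gen \<mu> v)
  from gen(2) show ?case
  proof (induction rule: gen_eigenspace_induct)
    case zero
    show ?case by (intro exI[of _ "[]"]) auto
  next
    case (shift v)
    then obtain ms where "set ms \<subseteq> P" "fold (shift A) ms (shift A \<mu> v) = 0" by blast
    then show ?case using gen(1) by (intro exI[of _ "\<mu> # ms"]) auto
  qed
qed

text \<open>\<open>shift A \<mu> y\<close> decays too and is killed by the shorter list, so it
  vanishes. Then \<open>y\<close> satisfies \<open>A^n y = \<mu>^n y\<close> with
  \<open>cmod \<mu> \<ge> 1\<close>, and can decay only if it is zero. This separates the stable
  part from the rest.\<close>

lemma decaying_annihilated_eq_0:
  fixes A :: "complex^'d^'d"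
  assumes "(\<lambda>n. norm (((*v) A ^^ n) y)) \<longlonglongrightarrow> 0"
    and "set ms \<subseteq> {\<mu>. cmod \<mu> \<ge> 1}" "fold (shift A) ms y = 0"
  shows "y = 0"
  using assms
proof (induction ms arbitrary: y)
  case Nil
  then show ?case by simp
next
  case (Cons \<mu> ms)
  have lim: "(\<lambda>n. ((*v) A ^^ n) y) \<longlonglongrightarrow> 0" using Cons.prems(1) tendsto_norm_zero_iff by blast
  have "(\<lambda>n. norm (((*v) A ^^ Suc n) y) + cmod \<mu> * norm (((*v) A ^^ n) y)) \<longlonglongrightarrow> 0 + cmod \<mu> * 0"
    by (intro tendsto_add tendsto_mult tendsto_const Cons.prems(1) LIMSEQ_Suc[OF Cons.prems(1)])
  then have "(\<lambda>n. norm (((*v) A ^^ n) (shift A \<mu> y))) \<longlonglongrightarrow> 0"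
    by (rule tendsto_0_le[where K = 1, OF tendsto_eq_rhs])
      (auto simp: funpow_shift_split simp flip: norm_vector_smult
        intro!: always_eventually norm_triangle_ineq4[THEN order_trans] simp del: funpow.simps)
  then have "shift A \<mu> y = 0" using Cons.IH Cons.prems by simp
  then have Ay: "A *v y = \<mu> *s y" by (simp add: shift_def)
  have "((*v) A ^^ n) y = \<mu> ^ n *s y" for n
    by (induction n) (auto simp: Ay vec.scale mult.commute)
  then have "(\<lambda>n. \<mu> ^ n * y $ i) \<longlonglongrightarrow> 0" for i
    using tendsto_vec_nth[OF lim, of i] by simp
  then have "y $ i = 0" for i
    by (rule power_mult_tendsto_0D) (use Cons.prems(2) in auto)
  then show ?case by (simp add: vec_eq_iff)
qed

lemma stable_splitting_complex:
  fixes A :: "complex^'d^'d"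
  shows "stable_splitting ((*v) A) (spectral_sum_complex A {\<mu>. cmod \<mu> < 1})
    (spectral_sum_complex A {\<mu>. cmod \<mu> \<ge> 1})" (is "stable_splitting _ ?S ?L")
  unfolding stable_splitting_def
proof (intro conjI allI ballI impI)
  show "?S \<inter> ?L \<subseteq> {0}"
  proof
    fix y assume y: "y \<in> ?S \<inter> ?L"
    then have "(\<lambda>n. norm (((*v) A ^^ n) y)) \<longlonglongrightarrow> 0"
      using summable_norm_stable summable_LIMSEQ_zero by blast
    then show "y \<in> {0}"
      using y spectral_sum_annihilated[of y A "{\<mu>. cmod \<mu> \<ge> 1}"] decaying_annihilated_eq_0 by blast
  qed
next
  fix x
  have "{\<mu>. cmod \<mu> < 1} \<union> {\<mu>. cmod \<mu> \<ge> 1} = UNIV" by auto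
  then have "?S + ?L = UNIV" by (simp add: spectral_sum_complex_Un spectral_sum_complex_UNIV)
  then have "x \<in> ?S + ?L" by simp
  then show "\<exists>s\<in>?S. \<exists>l\<in>?L. x = s + l" by (auto elim!: set_plus_elim)
next
  fix f :: "complex^'d \<Rightarrow> real" and l
  assume f: "linear f" and lim: "\<forall>y. (\<lambda>n. f (((*v) A ^^ n) y)) \<longlonglongrightarrow> 0" and l: "l \<in> ?L"
  \<comment> \<open>The complex-linear functional with real part \<open>f\<close>; the separating
    functional is only real-linear, while the eigenvalue argument uses complex scalars.\<close>
  define F where "F x = Complex (f x) (- f (\<i> *s x))" for x
  have "F l = 0"
  proof (rule functional_vanishes_unstable[OF _ _ _ l])
    fix x y show "F (x + y) = F x + F y"
      using f by (simp add: F_def linear_add vec.scale_right_distrib complex_eq_iff)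
  next
    fix c :: complex and x :: "complex^'d"
    have "c *s x = Re c *\<^sub>R x + Im c *\<^sub>R (\<i> *s x)"
      by (simp add: vec_eq_iff complex_eq_iff)
    moreover have "\<i> *s (c *s x) = Re c *\<^sub>R (\<i> *s x) - Im c *\<^sub>R x"
      by (simp add: vec_eq_iff complex_eq_iff)
    ultimately show "F (c *s x) = c * F x"
      using f unfolding F_def
      by (simp add: linear_add linear_diff linear_scale complex_eq_iff del: vector_smult_assoc)
  next
    fix y
    have "(\<lambda>n. f (\<i> *s ((*v) A ^^ n) y)) \<longlonglongrightarrow> 0"
      using lim by (simp flip: funpow_matrix_smult)
    then have "(\<lambda>n. - f (\<i> *s ((*v) A ^^ n) y)) \<longlonglongrightarrow> - 0" by (rule tendsto_minus)
    then have "(\<lambda>n. F (((*v) A ^^ n) y)) \<longlonglongrightarrow> Complex 0 (- 0)"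
      unfolding F_def using lim by (intro tendsto_Complex) auto
    then show "(\<lambda>n. F (((*v) A ^^ n) y)) \<longlonglongrightarrow> 0" by (simp add: zero_complex.code)
  qed
  then show "f l = 0" by (simp add: F_def complex_eq_iff)
qed (auto intro: subspace_if_vec_subspace subspace_spectral_sum_complex summable_norm_stable
    spectral_sum_complex_matrix)

subsection \<open>Control systems\<close>

lemma linear_matrix:
  fixes A :: "'k::real_normed_field^'n^'m"
  shows "linear ((*v) A)"
  by (rule linearI) (auto simp: matrix_vector_right_distrib scaleR_eq_smult vec.scale)

lemma reachable_set_eq_reach:
  fixes A :: "'k::real_normed_field^'d^'d"
  assumes "0 \<in> U"
  shows "reachable_set A B U = (\<Union>k. reach ((*v) A) ((*v) B ` U) k)"
proof (intro equalityI subsetI)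
  fix x assume "x \<in> reachable_set A B U"
  then obtain k u where u: "u \<in> controls U" "x = solution A B k 0 u"
    by (auto simp: reachable_set_def)
  define g where "g j = ((*v) A ^^ j) (B *v u (k - Suc j))" for j
  have "x = (\<Sum>i<k. g (k - Suc i))"
    using u(2) by (auto simp: solution_def funpow_matrix_0 g_def intro!: sum.cong)
  also have "\<dots> = (\<Sum>i<k. g i)" by (rule sum.nat_diff_reindex)
  also have "\<dots> \<in> reach ((*v) A) ((*v) B ` U) k"
    unfolding g_def using u(1) by (intro reachI) (auto simp: controls_def)
  finally show "x \<in> (\<Union>k. reach ((*v) A) ((*v) B ` U) k)" by blast
next
  fix x assume "x \<in> (\<Union>k. reach ((*v) A) ((*v) B ` U) k)"
  then obtain l where "x \<in> reach ((*v) A) ((*v) B ` U) l" by blast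
  moreover have "0 \<in> (*v) B ` U" using assms by force
  \<comment> \<open>\<open>l\<close> may be 0, while the reachable set asks for
    \<open>k \<ge> 1\<close>; one zero input makes up for this.\<close>
  ultimately have "x \<in> reach ((*v) A) ((*v) B ` U) (Suc l)"
    using reach_subset_Suc[OF linear_matrix] by blast
  then obtain k w where k: "k \<ge> 1" "x = (\<Sum>i<k. ((*v) A ^^ i) (w i))" "\<And>i. w i \<in> (*v) B ` U"
    by (auto elim!: reachE)
  then have "\<forall>i. \<exists>u\<in>U. w i = B *v u" by blast
  then obtain u where u: "\<And>i. u i \<in> U" "\<And>i. w i = B *v u i" by metis
  have "x = (\<Sum>i<k. ((*v) A ^^ (k - Suc i)) (B *v u (k - Suc i)))"
    by (simp add: k(2) u(2) sum.nat_diff_reindex[of "\<lambda>i. ((*v) A ^^ i) (B *v u i)"])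
  also have "\<dots> = solution A B k 0 (\<lambda>i. u (k - Suc i))"
    by (simp add: solution_def funpow_matrix_0)
  finally show "x \<in> reachable_set A B U"
    using k(1) u(1) unfolding reachable_set_def controls_def by blast
qed

lemma funpow_matrix_cancel:
  fixes A :: "'k::field^'d^'d"
  assumes "A ** A' = mat 1"
  shows "((*v) A ^^ (m + n)) (((*v) A' ^^ n) x) = ((*v) A ^^ m) x"
proof (induction n arbitrary: x)
  case (Suc n)
  have "((*v) A ^^ (m + Suc n)) (((*v) A' ^^ Suc n) x)
      = ((*v) A ^^ (m + n)) (A *v (A' *v ((*v) A' ^^ n) x))"
    by (simp add: funpow_swap1)
  also have "\<dots> = ((*v) A ^^ m) x"
    using Suc by (simp add: matrix_vector_mul_assoc assms)
  finally show ?case .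
qed simp

lemma funpow_matrix_sum:
  fixes A :: "'k::field^'d^'d"
  shows "((*v) A ^^ n) (\<Sum>i\<in>I. f i) = (\<Sum>i\<in>I. ((*v) A ^^ n) (f i))"
  by (induction I rule: infinite_finite_induct) (auto simp: funpow_matrix_0 funpow_matrix_add)

text \<open>Applying \<open>A'\<close> \<open>k\<close> times to
  \<open>solution A B k y u = 0\<close> yields \<open>y\<close> as the sum of
  \<open>A'^i (- A' B u_i)\<close>. Here the inputs appear in their original order.\<close>

lemma controllable_set_eq_reach:
  fixes A :: "'k::real_normed_field^'d^'d"
  assumes inv: "A ** A' = mat 1" "A' ** A = mat 1" and "0 \<in> U"
  shows "controllable_set A B U = (\<Union>k. reach ((*v) A') ((\<lambda>u. - (A' *v (B *v u))) ` U) k)"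
proof -
  define f where "f u = - (A' *v (B *v u))" for u
  have sol: "solution A B k y u = ((*v) A ^^ k) (y - (\<Sum>i<k. ((*v) A' ^^ i) (f (u i))))" for k y u
  proof -
    have "((*v) A ^^ k) (((*v) A' ^^ i) (f (u i))) = - ((*v) A ^^ (k - 1 - i)) (B *v u i)"
      if "i < k" for i
    proof -
      have "((*v) A' ^^ i) (f (u i)) = - ((*v) A' ^^ Suc i) (B *v u i)"
        unfolding f_def using linear_neg[OF linear_funpow[OF linear_matrix[of A']]]
        by (simp add: funpow_swap1)
      moreover have "k = (k - 1 - i) + Suc i" using that by simp
      ultimately show ?thesis
        using funpow_matrix_cancel[OF inv(1), of "k - 1 - i" "Suc i" "B *v u i"]
          linear_neg[OF linear_funpow[OF linear_matrix[of A]]] by metis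
    qed
    then show ?thesis
      by (simp add: solution_def funpow_matrix_diff funpow_matrix_sum sum_negf)
  qed
  have sol0: "solution A B k y u = 0 \<longleftrightarrow> y = (\<Sum>i<k. ((*v) A' ^^ i) (f (u i)))" for k y u
  proof
    assume "solution A B k y u = 0"
    then have "((*v) A' ^^ (0 + k)) (((*v) A ^^ k) (y - (\<Sum>i<k. ((*v) A' ^^ i) (f (u i))))) = 0"
      by (simp add: sol funpow_matrix_0)
    then show "y = (\<Sum>i<k. ((*v) A' ^^ i) (f (u i)))"
      unfolding funpow_matrix_cancel[OF inv(2)] by simp
  qed (simp add: sol funpow_matrix_0)
  show ?thesis
  proof (intro equalityI subsetI)
    fix y assume "y \<in> controllable_set A B U"
    then obtain k u where u: "u \<in> controls U" "y = (\<Sum>i<k. ((*v) A' ^^ i) (f (u i)))"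
      by (auto simp: controllable_set_def sol0)
    have "y \<in> reach ((*v) A') (f ` U) k"
      unfolding u(2) using u(1) by (intro reachI) (auto simp: controls_def)
    then show "y \<in> (\<Union>k. reach ((*v) A') ((\<lambda>u. - (A' *v (B *v u))) ` U) k)"
      unfolding f_def by blast
  next
    fix y assume "y \<in> (\<Union>k. reach ((*v) A') ((\<lambda>u. - (A' *v (B *v u))) ` U) k)"
    then obtain l where "y \<in> reach ((*v) A') (f ` U) l" unfolding f_def by blast
    moreover have "f 0 = 0" by (simp add: f_def)
    then have "0 \<in> f ` U" using assms(3) by (metis imageI)
    ultimately have "y \<in> reach ((*v) A') (f ` U) (Suc l)"
      using reach_subset_Suc[OF linear_matrix] by blast
    then obtain k w where k: "k \<ge> 1" "y = (\<Sum>i<k. ((*v) A' ^^ i) (w i))" "\<And>i. w i \<in> f ` U"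
      by (auto elim!: reachE)
    then have "\<forall>i. \<exists>u\<in>U. w i = f u" by blast
    then obtain u where u: "\<And>i. u i \<in> U" "\<And>i. w i = f (u i)" by metis
    then have "solution A B k y u = 0" by (simp add: sol0 k(2))
    then show "y \<in> controllable_set A B U"
      using k(1) u(1) unfolding controllable_set_def controls_def by blast
  qed
qed

section \<open>The rank condition and invariant subspaces\<close>

text \<open>The rank equals the number of row indices, so the rows are pairwise distinct and
  independent. Distinctness carries the independence of the set of rows over to the indexed
  family.\<close>

lemma surj_if_full_row_rank:
  fixes M :: "'k::field^'n^'m"
  assumes "rank M = CARD('m)"
  shows "surj ((*v) M)"
proof -
  have rows: "rows M = range (\<lambda>i. row i M)" by (auto simp: rows_def)
  then have fin: "finite (rows M)" by simp
  have dim: "vec.dim (rows M) = CARD('m)" using assms by (simp add: row_rank_def_gen)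
  have "card (rows M) \<le> CARD('m)" unfolding rows by (rule card_image_le) simp
  moreover have "CARD('m) \<le> card (rows M)" using vec.dim_le_card'[OF fin] dim by simp
  ultimately have card: "card (rows M) = CARD('m)" by simp
  then have inj: "inj (\<lambda>i. row i M)" unfolding rows by (intro eq_card_imp_inj_on) auto
  have indep: "vec.independent (rows M)"
    by (rule vec.card_le_dim_spanning[OF subset_refl vec.span_superset fin]) (simp add: card dim)
  have "c i = 0" if "(\<Sum>i\<in>UNIV. c i *s row i M) = 0" for c and i
  proof -
    have "(\<Sum>v\<in>rows M. c (inv (\<lambda>i. row i M) v) *s v) = 0"
      unfolding rows using that by (simp add: sum.reindex[OF inj] inv_f_f[OF inj])
    then have "c (inv (\<lambda>i. row i M) (row i M)) = 0"
      using indep fin rows by (auto simp: vec.dependent_finite)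
    then show ?thesis by (simp add: inv_f_f[OF inj])
  qed
  then show ?thesis
    using matrix_right_invertible_independent_rows[of M] matrix_right_invertible_surjective[of M]
    by blast
qed

lemma matrix_axis: "B *v axis j c = c *s column j (B :: 'k::field^'n^'m)"
  by (simp add: vec_eq_iff matrix_vector_mult_def axis_def column_def if_distrib cong: if_cong)

lemma invariant_subspace_UNIV_if_kalman:
  fixes A :: "'k::real_normed_field^'d^'d" and B :: "'k^'m^'d"
  assumes "rank (kalman_matrix A B) = CARD('d)"
    and X: "subspace X" "(*v) A ` X \<subseteq> X" "\<And>u. B *v u \<in> X"
  shows "X = UNIV"
proof -
  have "kalman_matrix A B *v x \<in> X" for x
  proof -
    have col: "column p (kalman_matrix A B)
        = ((*v) A ^^ to_nat_on (UNIV :: 'd set) (fst p)) (column (snd p) B)" for p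
      by (simp add: column_def kalman_matrix_def vec_eq_iff)
    \<comment> \<open>\<open>X\<close> is only a real subspace, so the scalar \<open>x $ p\<close>
      is moved into the input instead of being taken out as a factor.\<close>
    have "kalman_matrix A B *v x
        = (\<Sum>p\<in>UNIV. ((*v) A ^^ to_nat_on (UNIV :: 'd set) (fst p)) (B *v axis (snd p) (x $ p)))"
      unfolding matrix_mult_sum[of "kalman_matrix A B"] col matrix_axis funpow_matrix_smult ..
    also have "\<dots> \<in> X" using X by (intro subspace_sum funpow_in_invariant)
    finally show ?thesis .
  qed
  then show ?thesis using surj_if_full_row_rank[OF assms(1)] by (metis UNIV_eq_I surjD)
qed

lemma range_subset_if_symmetric_image_subset:
  fixes f :: "'v::real_normed_vector \<Rightarrow> 'w::real_vector"
  assumes "linear f" "0 \<in> interior U" "subspace X" "{w \<in> f ` U. - w \<in> f ` U} \<subseteq> X"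
  shows "f u \<in> X"
proof -
  obtain e where e: "e > 0" "ball 0 e \<subseteq> U" using assms(2) unfolding mem_interior by blast
  \<comment> \<open>Small enough that both \<open>r *\<^sub>R u\<close> and its negative lie in the
    ball of radius \<open>e\<close>; the denominator is positive also for
    \<open>u = 0\<close>.\<close>
  define r where "r = e / (norm u + e + 1)"
  have pos: "norm u + e + 1 > 0" using e by (simp add: add_nonneg_pos)
  then have r: "r > 0" using e by (simp add: r_def)
  have "r * norm u < e"
    using e pos by (simp add: r_def field_simps add_pos_pos)
  then have "r *\<^sub>R u \<in> U" "- (r *\<^sub>R u) \<in> U" using e r by (auto intro!: subsetD[OF e(2)])
  then have "f (r *\<^sub>R u) \<in> f ` U" "- f (r *\<^sub>R u) \<in> f ` U"
    using linear_neg[OF assms(1)] by (metis imageI)+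
  then have "f (r *\<^sub>R u) \<in> X" using assms(4) by blast
  then have "(1 / r) *\<^sub>R f (r *\<^sub>R u) \<in> X" using assms(3) by (simp add: subspace_scale)
  then show ?thesis using r assms(1) by (simp add: linear_scale)
qed

lemma image_subspace_eq_if_subset:
  fixes f :: "'v::euclidean_space \<Rightarrow> 'v"
  assumes "linear f" "inj f" "subspace X" "f ` X \<subseteq> X"
  shows "f ` X = X"
  using assms by (intro subspace_dim_equal)
    (auto simp: linear_subspace_image dim_image_eq inj_on_subset)

text \<open>Both claims are instances of the same decomposition, for \<open>A\<close> with inputs
  \<open>B u\<close> and for \<open>A'\<close> with inputs \<open>- A' B u\<close>.\<close>

lemma reachable_and_controllable_decomposition:
  fixes A :: "'k::{real_normed_field,euclidean_space}^'d^'d" and B :: "'k^'m^'d"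
  assumes inv: "A ** A' = mat 1" "A' ** A = mat 1"
    and U: "compact U" "convex U" "0 \<in> interior U"
    and rank: "rank (kalman_matrix A B) = CARD('d)"
  shows "stable_splitting ((*v) A) S L \<Longrightarrow>
      \<exists>K. compact K \<and> convex K \<and> K \<subseteq> S \<and> top_of_set S interior_of K \<noteq> {} \<and>
        closure (reachable_set A B U) = K + L \<and> 0 \<in> K \<and> L \<subseteq> interior (reachable_set A B U)"
    and "stable_splitting ((*v) A') S L \<Longrightarrow>
      \<exists>K. compact K \<and> convex K \<and> K \<subseteq> S \<and> top_of_set S interior_of K \<noteq> {} \<and>
        closure (controllable_set A B U) = K + L \<and> 0 \<in> K \<and> L \<subseteq> interior (controllable_set A B U)"
proof -
  have U0: "0 \<in> U" using U(3) interior_subset by blast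
  show "\<exists>K. compact K \<and> convex K \<and> K \<subseteq> S \<and> top_of_set S interior_of K \<noteq> {} \<and>
        closure (reachable_set A B U) = K + L \<and> 0 \<in> K \<and> L \<subseteq> interior (reachable_set A B U)"
    if "stable_splitting ((*v) A) S L"
    unfolding reachable_set_eq_reach[OF U0]
  proof (rule closure_reach_decomposition[OF linear_matrix _ _ _ _ that])
    show "compact ((*v) B ` U)"
      by (intro compact_continuous_image linear_continuous_on U)
        (simp add: linear_linear linear_matrix)
    show "convex ((*v) B ` U)" by (intro convex_linear_image linear_matrix U)
    show "0 \<in> (*v) B ` U" using U0 by force
    fix X assume X: "subspace X" "(*v) A ` X \<subseteq> X" "{w \<in> (*v) B ` U. - w \<in> (*v) B ` U} \<subseteq> X"
    then show "X = UNIV"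
      using range_subset_if_symmetric_image_subset[OF linear_matrix U(3)]
      by (intro invariant_subspace_UNIV_if_kalman[OF rank]) blast+
  qed
  define f where "f u = - (A' *v (B *v u))" for u
  have f: "linear f"
    by (rule linearI) (auto simp: f_def matrix_vector_right_distrib scaleR_eq_smult vec.scale)
  show "\<exists>K. compact K \<and> convex K \<and> K \<subseteq> S \<and> top_of_set S interior_of K \<noteq> {} \<and>
        closure (controllable_set A B U) = K + L \<and> 0 \<in> K \<and> L \<subseteq> interior (controllable_set A B U)"
    if "stable_splitting ((*v) A') S L"
    unfolding controllable_set_eq_reach[OF inv U0] f_def[symmetric]
  proof (rule closure_reach_decomposition[OF linear_matrix _ _ _ _ that])
    show "compact (f ` U)"
      by (intro compact_continuous_image linear_continuous_on U) (simp add: linear_linear f)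
    show "convex (f ` U)" by (intro convex_linear_image f U)
    show "0 \<in> f ` U" using U0 linear_0[OF f] by (metis imageI)
    fix X assume X: "subspace X" "(*v) A' ` X \<subseteq> X" "{w \<in> f ` U. - w \<in> f ` U} \<subseteq> X"
    have AA': "A *v (A' *v x) = x" "A' *v (A *v x) = x" for x
      using inv by (simp_all add: matrix_vector_mul_assoc)
    have "inj ((*v) A')" by (metis AA'(1) injI)
    \<comment> \<open>Invariance under the injective \<open>A'\<close> is equality in finite
      dimension, so \<open>X\<close> is \<open>A\<close>-invariant as well. Hence the rank condition
      for \<open>A\<close> and \<open>B\<close> also settles the inverse system.\<close>
    then have eq: "(*v) A' ` X = X"
      using X by (intro image_subspace_eq_if_subset linear_matrix) auto
    have AX: "(*v) A ` X \<subseteq> X"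
    proof clarify
      fix x assume "x \<in> X"
      then obtain z where "z \<in> X" "x = A' *v z" using eq by blast
      then show "A *v x \<in> X" by (simp add: AA')
    qed
    have "B *v u \<in> X" for u
    proof -
      have "- f u \<in> X"
        using range_subset_if_symmetric_image_subset[OF f U(3) X(1,3)] X(1) subspace_neg by blast
      then have "A *v (A' *v (B *v u)) \<in> X" using AX by (auto simp: f_def)
      then show ?thesis by (simp add: AA')
    qed
    then show "X = UNIV" by (rule invariant_subspace_UNIV_if_kalman[OF rank X(1) AX])
  qed
qed

subsection \<open>Spectral subspaces of the inverse matrix\<close>

text \<open>From \<open>A' - (1/\<mu>) I = - (1/\<mu>) A' (A - \<mu> I)\<close>, generalized
  eigenvectors of \<open>A\<close> for \<open>\<mu>\<close> are such for \<open>A'\<close> and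
  \<open>1/\<mu>\<close>. The value 0 is no eigenvalue of \<open>A\<close> and contributes only the
  zero vector.\<close>

lemma spectral_sum_complex_inverse_subset:
  assumes inv: "A' ** A = mat 1" and PQ: "\<And>\<mu>. \<mu> \<noteq> 0 \<Longrightarrow> \<mu> \<in> P \<Longrightarrow> inverse \<mu> \<in> Q"
  shows "spectral_sum_complex A P \<subseteq> spectral_sum_complex A' Q"
proof
  have A'A: "A' *v (A *v x) = x" for x
    using inv by (simp add: matrix_vector_mul_assoc)
  fix v assume "v \<in> spectral_sum_complex A P"
  then show "v \<in> spectral_sum_complex A' Q"
  proof (induction rule: spectral_sum_complex_induct)
    case (gen \<mu> v)
    show ?case
    proof (cases "\<mu> = 0")
      case True
      have "0 \<notin> eigenvalues A"
        using A'A by (auto simp: eigenvalues_def) (metis matrix_vector_mult_0_right)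
      then have "v = 0" using gen(2) True gen_eigenspace_trivial by blast
      then show ?thesis by (simp add: vec.subspace_0 subspace_spectral_sum_complex)
    next
      case False
      from gen(2) have "v \<in> gen_eigenspace A' (inverse \<mu>)"
      proof (induction rule: gen_eigenspace_induct)
        case zero
        show ?case by (simp add: vec.subspace_0 subspace_gen_eigenspace)
      next
        case (shift v)
        have "shift A' (inverse \<mu>) v = (- inverse \<mu>) *s (A' *v shift A \<mu> v)"
          using False by (simp add: shift_def vec.diff vec.scale A'A vec.scale_right_diff_distrib)
        also have "\<dots> \<in> gen_eigenspace A' (inverse \<mu>)"
          by (intro vec.subspace_scale subspace_gen_eigenspace gen_eigenspace_matrix shift.IH)
        finally show ?case by (rule gen_eigenspaceI)
      qed
      then show ?thesis using PQ[OF False gen(1)] by (rule spectral_sum_complex_base[rotated])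
    qed
  qed (auto intro: vec.subspace_0 vec.subspace_add vec.subspace_scale subspace_spectral_sum_complex)
qed

lemma norm_inverse_conv:
  assumes "(\<mu> :: complex) \<noteq> 0"
  shows "cmod (inverse \<mu>) < 1 \<longleftrightarrow> cmod \<mu> > 1" "cmod (inverse \<mu>) \<ge> 1 \<longleftrightarrow> cmod \<mu> \<le> 1"
  using assms by (auto simp: norm_inverse norm_divide field_simps)

text \<open>Each equality applies the inclusion twice, with \<open>A\<close> and \<open>A'\<close>
  exchanged.\<close>

lemma spectral_sum_complex_inverse:
  assumes inv: "A ** A' = mat 1" "A' ** A = mat 1"
  shows "spectral_sum_complex A' {\<mu>. cmod \<mu> < 1} = spectral_sum_complex A {\<mu>. cmod \<mu> > 1}"
    and "spectral_sum_complex A' {\<mu>. cmod \<mu> \<ge> 1} = spectral_sum_complex A {\<mu>. cmod \<mu> \<le> 1}"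
proof -
  show "spectral_sum_complex A' {\<mu>. cmod \<mu> < 1} = spectral_sum_complex A {\<mu>. cmod \<mu> > 1}"
    by (intro equalityI spectral_sum_complex_inverse_subset inv)
      (use norm_inverse_conv norm_inverse_conv[of "inverse _"] in auto)
  show "spectral_sum_complex A' {\<mu>. cmod \<mu> \<ge> 1} = spectral_sum_complex A {\<mu>. cmod \<mu> \<le> 1}"
    by (intro equalityI spectral_sum_complex_inverse_subset inv)
      (use norm_inverse_conv norm_inverse_conv[of "inverse _"] in auto)
qed

subsection \<open>Complexification of real matrices\<close>

definition cplx_vec :: "real^'n \<Rightarrow> complex^'n" where
  "cplx_vec x = (\<chi> i. complex_of_real (x $ i))"

definition re_vec :: "complex^'n \<Rightarrow> real^'n" where
  "re_vec v = (\<chi> i. Re (v $ i))"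

definition im_vec :: "complex^'n \<Rightarrow> real^'n" where
  "im_vec v = (\<chi> i. Im (v $ i))"

definition cnj_vec :: "complex^'n \<Rightarrow> complex^'n" where
  "cnj_vec v = (\<chi> i. cnj (v $ i))"

abbreviation cplx_mat :: "real^'n^'m \<Rightarrow> complex^'n^'m" where
  "cplx_mat \<equiv> map_matrix complex_of_real"

lemmas vec_parts_defs = cplx_vec_def re_vec_def im_vec_def cnj_vec_def

lemma re_im_cplx_vec [simp]: "re_vec (cplx_vec x) = x" "im_vec (cplx_vec x) = 0"
  by (auto simp: vec_eq_iff vec_parts_defs)

lemma vec_parts_add:
  "cplx_vec (x + y) = cplx_vec x + cplx_vec y"
  "re_vec (v + w) = re_vec v + re_vec w"
  "im_vec (v + w) = im_vec v + im_vec w"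
  "cnj_vec (v + w) = cnj_vec v + cnj_vec w"
  by (auto simp: vec_eq_iff vec_parts_defs)

lemma vec_parts_0 [simp]: "cplx_vec 0 = 0" "re_vec 0 = 0" "im_vec 0 = 0" "cnj_vec 0 = 0"
  by (auto simp: vec_eq_iff vec_parts_defs)

lemma vec_parts_smult:
  "cplx_vec (r *\<^sub>R x) = of_real r *s cplx_vec x"
  "re_vec (c *s v) = Re c *\<^sub>R re_vec v - Im c *\<^sub>R im_vec v"
  "im_vec (c *s v) = Re c *\<^sub>R im_vec v + Im c *\<^sub>R re_vec v"
  "cnj_vec (c *s v) = cnj c *s cnj_vec v"
  by (auto simp: vec_eq_iff vec_parts_defs)

lemma vec_parts_matrix:
  "cplx_mat A *v cplx_vec x = cplx_vec (A *v x)"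
  "re_vec (cplx_mat A *v v) = A *v re_vec v"
  "cnj_vec (cplx_mat A *v v) = cplx_mat A *v cnj_vec v"
  by (auto simp: vec_eq_iff vec_parts_defs matrix_vector_mult_def)

lemma re_vec_funpow:
  fixes A :: "real^'n^'n"
  shows "re_vec (((*v) (cplx_mat A) ^^ n) v) = ((*v) A ^^ n) (re_vec v)"
  by (induction n) (auto simp: vec_parts_matrix)

lemma cplx_vec_funpow:
  fixes A :: "real^'n^'n"
  shows "((*v) (cplx_mat A) ^^ n) (cplx_vec x) = cplx_vec (((*v) A ^^ n) x)"
  by (induction n) (auto simp: vec_parts_matrix)

lemma cplx_vec_re_im:
  "cplx_vec (re_vec v) = (1/2) *s (v + cnj_vec v)"
  "cplx_vec (im_vec v) = (- \<i> / 2) *s (v + (- 1) *s cnj_vec v)"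
  by (auto simp: vec_eq_iff vec_parts_defs complex_eq_iff)

lemma norm_cplx_vec: "norm (cplx_vec x) = norm x"
  by (simp add: norm_vec_def cplx_vec_def)

section \<open>Conjugation and real spectral sums\<close>

lemma cnj_vec_gen_eigenspace:
  assumes "v \<in> gen_eigenspace (cplx_mat A) \<mu>"
  shows "cnj_vec v \<in> gen_eigenspace (cplx_mat A) (cnj \<mu>)"
  using assms
proof (induction rule: gen_eigenspace_induct)
  case zero
  show ?case by (simp add: vec.subspace_0 subspace_gen_eigenspace)
next
  case (shift v)
  have "cnj_vec (shift (cplx_mat A) \<mu> v) = shift (cplx_mat A) (cnj \<mu>) (cnj_vec v)"
    by (simp add: shift_def vec_parts_matrix(3)[symmetric]) (simp add: vec_eq_iff cnj_vec_def)
  then show ?case using shift.IH gen_eigenspaceI by metis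
qed

lemma cnj_vec_spectral_sum:
  assumes cnj: "\<And>\<mu>. \<mu> \<in> P \<Longrightarrow> cnj \<mu> \<in> P" and "v \<in> spectral_sum_complex (cplx_mat A) P"
  shows "cnj_vec v \<in> spectral_sum_complex (cplx_mat A) P"
  using assms(2)
proof (induction rule: spectral_sum_complex_induct)
  case (gen \<mu> v)
  then show ?case by (intro spectral_sum_complex_base[OF cnj] cnj_vec_gen_eigenspace)
qed (auto simp: vec_parts_add vec_parts_smult
    intro: vec.subspace_0 vec.subspace_add vec.subspace_scale subspace_spectral_sum_complex)

text \<open>Real and imaginary parts are complex combinations of \<open>v\<close> and its conjugate,
  and the conjugate stays in the sum as \<open>P\<close> is closed under conjugation.\<close>

lemma cplx_vec_re_im_spectral_sum:
  assumes "\<And>\<mu>. \<mu> \<in> P \<Longrightarrow> cnj \<mu> \<in> P" and "v \<in> spectral_sum_complex (cplx_mat A) P"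
  shows "cplx_vec (re_vec v) \<in> spectral_sum_complex (cplx_mat A) P"
    and "cplx_vec (im_vec v) \<in> spectral_sum_complex (cplx_mat A) P"
proof -
  note sub = subspace_spectral_sum_complex[of "cplx_mat A" P]
  note cnj_v = cnj_vec_spectral_sum[OF assms]
  show "cplx_vec (re_vec v) \<in> spectral_sum_complex (cplx_mat A) P"
    unfolding cplx_vec_re_im(1)
    by (rule vec.subspace_scale[OF sub vec.subspace_add[OF sub assms(2) cnj_v]])
  show "cplx_vec (im_vec v) \<in> spectral_sum_complex (cplx_mat A) P"
    unfolding cplx_vec_re_im(2)
    by (rule vec.subspace_scale[OF sub
          vec.subspace_add[OF sub assms(2) vec.subspace_scale[OF sub cnj_v]]])
qed

lemma gen_real_eigenspace_altdef:
  "gen_real_eigenspace A \<mu> =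
    span (re_vec ` gen_eigenspace (cplx_mat A) \<mu> \<union> im_vec ` gen_eigenspace (cplx_mat A) \<mu>)"
  by (simp add: gen_real_eigenspace_def Let_def re_vec_def[abs_def] im_vec_def[abs_def])

text \<open>Real spectral sums are the real points of the complex ones, so facts about the
  complexification can be read off for \<open>A\<close>.\<close>

lemma spectral_sum_real_altdef:
  assumes cnj: "\<And>\<mu>. \<mu> \<in> P \<Longrightarrow> cnj \<mu> \<in> P"
  shows "spectral_sum_real A P = {x. cplx_vec x \<in> spectral_sum_complex (cplx_mat A) P}" (is "_ = ?X")
proof
  have X: "subspace ?X"
    by (auto simp: subspace_def vec_parts_add vec_parts_smult intro: vec.subspace_0 vec.subspace_add
        vec.subspace_scale subspace_spectral_sum_complex)
  show "spectral_sum_real A P \<subseteq> ?X"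
    unfolding spectral_sum_real_def gen_real_eigenspace_altdef
  proof (intro span_minimal X UN_least Un_least)
    fix \<mu> assume "\<mu> \<in> eigenvalues (cplx_mat A) \<inter> P"
    then show "re_vec ` gen_eigenspace (cplx_mat A) \<mu> \<subseteq> ?X"
      "im_vec ` gen_eigenspace (cplx_mat A) \<mu> \<subseteq> ?X"
      using cplx_vec_re_im_spectral_sum[OF cnj] spectral_sum_complex_base by blast+
  qed
  show "?X \<subseteq> spectral_sum_real A P"
  proof clarify
    fix x assume "cplx_vec x \<in> spectral_sum_complex (cplx_mat A) P"
    \<comment> \<open>Both parts go through the induction together, since multiplication by a
      complex scalar mixes them.\<close>
    moreover have "re_vec v \<in> spectral_sum_real A P \<and> im_vec v \<in> spectral_sum_real A P"
      if "v \<in> spectral_sum_complex (cplx_mat A) P" for v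
      using that
    proof (induction rule: spectral_sum_complex_induct)
      case (gen \<mu> v)
      show ?case
      proof (cases "\<mu> \<in> eigenvalues (cplx_mat A)")
        case True
        have "re_vec v \<in> gen_real_eigenspace A \<mu>" "im_vec v \<in> gen_real_eigenspace A \<mu>"
          unfolding gen_real_eigenspace_altdef using gen(2) by (auto intro: span_base)
        then show ?thesis
          unfolding spectral_sum_real_def using True gen(1) by (auto intro!: span_base)
      next
        case False
        then have "v = 0" using gen(2) by (rule gen_eigenspace_trivial)
        then show ?thesis by (simp add: spectral_sum_real_def span_zero)
      qed
    qed (auto simp: vec_parts_add vec_parts_smult spectral_sum_real_def
        intro: span_zero span_add span_diff span_scale)
    ultimately show "x \<in> spectral_sum_real A P" by fastforce
  qed
qed

lemma spectral_sum_real_Un: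
  "spectral_sum_real A P + spectral_sum_real A Q = spectral_sum_real A (P \<union> Q)"
  unfolding spectral_sum_real_def Int_Un_distrib UN_Un by (auto simp: span_Un set_plus_def)

text \<open>A real vector is split over the complex numbers, and the real parts of its components
  stay in \<open>S\<close> and \<open>L\<close>; orbits and norms agree under the embedding.\<close>

lemma stable_splitting_real_parts:
  assumes split: "stable_splitting ((*v) (cplx_mat A)) S L"
    and S: "\<And>v. v \<in> S \<Longrightarrow> cplx_vec (re_vec v) \<in> S" and L: "\<And>v. v \<in> L \<Longrightarrow> cplx_vec (re_vec v) \<in> L"
  shows "stable_splitting ((*v) A) {x. cplx_vec x \<in> S} {x. cplx_vec x \<in> L}"
proof -
  have sub: "subspace {x. cplx_vec x \<in> X}" if "subspace X" for X :: "(complex^'a) set"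
    using that by (auto simp: subspace_def vec_parts_add vec_parts_smult simp flip: scaleR_eq_smult)
  have inv: "(*v) A ` {x. cplx_vec x \<in> X} \<subseteq> {x. cplx_vec x \<in> X}"
    if "(*v) (cplx_mat A) ` X \<subseteq> X" for X
    using that by (auto simp flip: vec_parts_matrix)
  have "\<exists>s\<in>{x. cplx_vec x \<in> S}. \<exists>l\<in>{x. cplx_vec x \<in> L}. x = s + l" for x
  proof -
    obtain s l where sl: "s \<in> S" "l \<in> L" "cplx_vec x = s + l"
      using split unfolding stable_splitting_def by blast
    then have "x = re_vec s + re_vec l"
      by (metis re_im_cplx_vec(1) vec_parts_add(2))
    then show ?thesis using S[OF sl(1)] L[OF sl(2)] by blast
  qed
  moreover have "x = 0" if "cplx_vec x \<in> S" "cplx_vec x \<in> L" for x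
  proof -
    have "cplx_vec x = 0" using split that unfolding stable_splitting_def by blast
    then show ?thesis by (metis re_im_cplx_vec(1) vec_parts_0(2))
  qed
  moreover have "summable (\<lambda>n. norm (((*v) A ^^ n) x))" if "cplx_vec x \<in> S" for x
    using split that unfolding stable_splitting_def
    by (auto simp: cplx_vec_funpow norm_cplx_vec dest: bspec)
  moreover have "f x = 0" if f: "linear f" "\<forall>y. (\<lambda>n. f (((*v) A ^^ n) y)) \<longlonglongrightarrow> 0" "cplx_vec x \<in> L"
    for f :: "real^'a \<Rightarrow> real" and x
  proof -
    \<comment> \<open>A real functional extends along the real part to a real-linear one on the
      complex space, the kind that \<open>stable_splitting\<close> quantifies over.\<close>
    have "linear (\<lambda>v. f (re_vec v))"
      using f(1) by (intro linearI)
        (auto simp: vec_parts_add vec_parts_smult linear_add linear_scale scaleR_eq_smult[where 'k = complex])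
    moreover have "\<forall>v. (\<lambda>n. f (re_vec (((*v) (cplx_mat A) ^^ n) v))) \<longlonglongrightarrow> 0"
      using f(2) by (simp add: re_vec_funpow)
    ultimately have "f (re_vec (cplx_vec x)) = 0"
      using split f(3) unfolding stable_splitting_def by blast
    then show ?thesis by simp
  qed
  ultimately show ?thesis
    using split sub inv unfolding stable_splitting_def by auto
qed

lemma stable_splitting_real:
  "stable_splitting ((*v) A) (spectral_sum_real A {\<mu>. cmod \<mu> < 1})
    (spectral_sum_real A {\<mu>. cmod \<mu> \<ge> 1})"
proof -
  have S: "spectral_sum_real A {\<mu>. cmod \<mu> < 1}
      = {x. cplx_vec x \<in> spectral_sum_complex (cplx_mat A) {\<mu>. cmod \<mu> < 1}}"
    and L: "spectral_sum_real A {\<mu>. cmod \<mu> \<ge> 1}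
      = {x. cplx_vec x \<in> spectral_sum_complex (cplx_mat A) {\<mu>. cmod \<mu> \<ge> 1}}"
    by (rule spectral_sum_real_altdef; simp)+
  show ?thesis unfolding S L
    by (rule stable_splitting_real_parts[OF stable_splitting_complex];
        erule cplx_vec_re_im_spectral_sum(1)[rotated]; simp)
qed

lemma cplx_mat_inverse:
  assumes "A ** A' = mat 1"
  shows "cplx_mat A ** cplx_mat A' = mat 1"
proof -
  have "cplx_mat A ** cplx_mat A' = cplx_mat (A ** A')"
    by (simp add: vec_eq_iff matrix_matrix_mult_def)
  also have "\<dots> = mat 1" by (simp add: assms vec_eq_iff mat_def)
  finally show ?thesis .
qed

lemma spectral_sum_real_inverse:
  assumes "A ** A' = mat 1" "A' ** A = mat 1"
  shows "spectral_sum_real A' {\<mu>. cmod \<mu> < 1} = spectral_sum_real A {\<mu>. cmod \<mu> > 1}"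
    and "spectral_sum_real A' {\<mu>. cmod \<mu> \<ge> 1} = spectral_sum_real A {\<mu>. cmod \<mu> \<le> 1}"
proof -
  note inv = assms[THEN cplx_mat_inverse]
  show "spectral_sum_real A' {\<mu>. cmod \<mu> < 1} = spectral_sum_real A {\<mu>. cmod \<mu> > 1}"
    by (subst (1 2) spectral_sum_real_altdef) (simp_all add: spectral_sum_complex_inverse[OF inv])
  show "spectral_sum_real A' {\<mu>. cmod \<mu> \<ge> 1} = spectral_sum_real A {\<mu>. cmod \<mu> \<le> 1}"
    by (subst (1 2) spectral_sum_real_altdef) (simp_all add: spectral_sum_complex_inverse[OF inv])
qed

section \<open>Joining the centre to the other parts, and the theorem for both fields\<close>

lemma norm_ge_1_Un: "{\<mu>. cmod \<mu> > 1} \<union> {\<mu>. cmod \<mu> = 1} = {\<mu>. cmod \<mu> \<ge> 1}"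
  and norm_le_1_Un: "{\<mu>. cmod \<mu> < 1} \<union> {\<mu>. cmod \<mu> = 1} = {\<mu>. cmod \<mu> \<le> 1}"
  by auto

theorem theorem15:
  shows
    "(\<forall>(A :: real^'d^'d) (B :: real^'m^'d) (U :: (real^'m) set).
      invertible A \<and>
      compact U \<and> convex U \<and> 0 \<in> interior U \<and> U = closure (interior U) \<and>
      rank (kalman_matrix A B) = CARD('d)
      \<longrightarrow>
         (\<exists>K. compact K \<and> convex K \<and> K \<subseteq> stable_space_real A \<and>
            top_of_set (stable_space_real A) interior_of K \<noteq> {} \<and>
            closure (reachable_set A B U) = K + (unstable_space_real A + center_space_real A) \<and>
            0 \<in> K \<and>
            unstable_space_real A + center_space_real A \<subseteq> interior (reachable_set A B U)) \<and>
         (\<exists>F. compact F \<and> convex F \<and> F \<subseteq> unstable_space_real A \<and>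
            top_of_set (unstable_space_real A) interior_of F \<noteq> {} \<and>
            closure (controllable_set A B U) = F + (stable_space_real A + center_space_real A) \<and>
            0 \<in> F \<and>
            stable_space_real A + center_space_real A \<subseteq> interior (controllable_set A B U)))
     \<and>
     (\<forall>(A :: complex^'d^'d) (B :: complex^'m^'d) (U :: (complex^'m) set).
      invertible A \<and>
      compact U \<and> convex U \<and> 0 \<in> interior U \<and> U = closure (interior U) \<and>
      rank (kalman_matrix A B) = CARD('d)
      \<longrightarrow>
         (\<exists>K. compact K \<and> convex K \<and> K \<subseteq> stable_space_complex A \<and>
            top_of_set (stable_space_complex A) interior_of K \<noteq> {} \<and>
            closure (reachable_set A B U) = K + (unstable_space_complex A + center_space_complex A) \<and>
            0 \<in> K \<and>
            unstable_space_complex A + center_space_complex A \<subseteq> interior (reachable_set A B U)) \<and>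
         (\<exists>F. compact F \<and> convex F \<and> F \<subseteq> unstable_space_complex A \<and>
            top_of_set (unstable_space_complex A) interior_of F \<noteq> {} \<and>
            closure (controllable_set A B U) = F + (stable_space_complex A + center_space_complex A) \<and>
            0 \<in> F \<and>
            stable_space_complex A + center_space_complex A \<subseteq> interior (controllable_set A B U)))"
proof (intro conjI allI impI; elim conjE)
  fix A :: "real^'d^'d" and B :: "real^'m^'d" and U :: "(real^'m) set"
  assume "invertible A" and U: "compact U" "convex U" "0 \<in> interior U"
    and rank: "rank (kalman_matrix A B) = CARD('d)"
  then obtain A' where inv: "A ** A' = mat 1" "A' ** A = mat 1" by (auto simp: invertible_def)
  note dec = reachable_and_controllable_decomposition[OF inv U rank]
  note spaces = stable_space_real_def center_space_real_def unstable_space_real_def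
    spectral_sum_real_Un norm_ge_1_Un norm_le_1_Un
  show "\<exists>K. compact K \<and> convex K \<and> K \<subseteq> stable_space_real A \<and>
      top_of_set (stable_space_real A) interior_of K \<noteq> {} \<and>
      closure (reachable_set A B U) = K + (unstable_space_real A + center_space_real A) \<and>
      0 \<in> K \<and>
      unstable_space_real A + center_space_real A \<subseteq> interior (reachable_set A B U)"
    unfolding spaces by (rule dec(1)) (rule stable_splitting_real)
  show "\<exists>F. compact F \<and> convex F \<and> F \<subseteq> unstable_space_real A \<and>
      top_of_set (unstable_space_real A) interior_of F \<noteq> {} \<and>
      closure (controllable_set A B U) = F + (stable_space_real A + center_space_real A) \<and>
      0 \<in> F \<and>
      stable_space_real A + center_space_real A \<subseteq> interior (controllable_set A B U)"
    \<comment> \<open>The splitting used is that of \<open>A'\<close>: its stable part is the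
      unstable space of \<open>A\<close>, and its complement is the stable plus centre space of
      \<open>A\<close>.\<close>
    unfolding spaces
    by (rule dec(2)) (use stable_splitting_real[of A'] in \<open>simp add: spectral_sum_real_inverse[OF inv]\<close>)
next
  fix A :: "complex^'d^'d" and B :: "complex^'m^'d" and U :: "(complex^'m) set"
  assume "invertible A" and U: "compact U" "convex U" "0 \<in> interior U"
    and rank: "rank (kalman_matrix A B) = CARD('d)"
  then obtain A' where inv: "A ** A' = mat 1" "A' ** A = mat 1" by (auto simp: invertible_def)
  note dec = reachable_and_controllable_decomposition[OF inv U rank]
  note spaces = stable_space_complex_def center_space_complex_def unstable_space_complex_def
    spectral_sum_complex_Un norm_ge_1_Un norm_le_1_Un
  show "\<exists>K. compact K \<and> convex K \<and> K \<subseteq> stable_space_complex A \<and>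
      top_of_set (stable_space_complex A) interior_of K \<noteq> {} \<and>
      closure (reachable_set A B U) = K + (unstable_space_complex A + center_space_complex A) \<and>
      0 \<in> K \<and>
      unstable_space_complex A + center_space_complex A \<subseteq> interior (reachable_set A B U)"
    unfolding spaces by (rule dec(1)) (rule stable_splitting_complex)
  show "\<exists>F. compact F \<and> convex F \<and> F \<subseteq> unstable_space_complex A \<and>
      top_of_set (unstable_space_complex A) interior_of F \<noteq> {} \<and>
      closure (controllable_set A B U) = F + (stable_space_complex A + center_space_complex A) \<and>
      0 \<in> F \<and>
      stable_space_complex A + center_space_complex A \<subseteq> interior (controllable_set A B U)"
    unfolding spaces
    by (rule dec(2)) (use stable_splitting_complex[of A'] in \<open>simp add: spectral_sum_complex_inverse[OF inv]\<close>)
qed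

end
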